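(* Assume every finite-measure Borel subset of $\mathcal V$ lies in $\mathcal A_{1,c}$ for some fixed $c>0$. Let $\mathcal O=\{\mathcal O_\varepsilon\}_{0<\varepsilon\le1}$ be a family of identity neighbourhoods in $G$ with $\mu_\Gamma(\mathcal O_\varepsilon)\ge\delta_0\varepsilon^d$ and $\mathcal O_{\varepsilon_1}\mathcal O_{\varepsilon_2}\subseteq\mathcal O_{\eta(\varepsilon_1+\varepsilon_2)}$ for some $\delta_0,d,\eta>0$, and let $\{B_t\}_{t\ge1}$ be an increasing family of subsets of $\mathcal V$ with $$B_{t(1-\varepsilon)}\subseteq\bigcap_{h\in\mathcal O_\varepsilon}B_th\subseteq\bigcup_{h\in\mathcal O_\varepsilon}B_th\subseteq B_{t(1+\varepsilon)}.$$ Let $F:\mathcal V\to\mathbb R^m$, $F_g(\bm v)=F(\bm vg)$, and let $\Upsilon$ be a family of finite-volume Borel subsets of $\mathbb R^m$ such that for all $\Omega\in\Upsilon$ and $g\in G$, $$m_{\mathcal V}(F_g^{-1}(\Omega)\cap B_t)=c(g)\mathrm{vol}(\Omega)t^a(1+O_g(t^{-\delta}))$$ for some uniform $a,\delta>0$, where $c(g)$ and the implied constant are uniformly bounded on compact sets. Let $\{\Omega_t\}_{t>1}\subseteq\Upsilon$ be a decreasing family (shrinking targets) with $\mathrm{vol}(\Omega_t)=t^{-b}$, $0<b<a$. Then for any $0<\nu<\min\{\delta,\frac{a-b}{d+3}\}$, for $\mu_\Gamma$-a.e. $g\in G$ there is $t_0=t_0(g)$ such that for all $t\ge t_0$, $$\#\{\bm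 v\in\mathcal L: F_g(\bm v)\in\Omega_t,\ \bm v\in B_t\}=c(g)\mathrm{vol}(\Omega_t)t^a(1+O(t^{-\nu})).$$
   Context: General setting: $\mathcal V\subseteq\mathbb R^N$ an algebraic variety with a transitive right action of a real unimodular algebraic group $G$; $\Gamma\le G$ a non-uniform lattice; $\mathcal L\subseteq\mathcal V$ an infinite discrete set with $\mathcal L\gamma=\mathcal L$ for $\gamma\in\Gamma$; $\mu_\Gamma$ the $G$-invariant probability measure on $\Gamma\backslash G$, also denoting the Haar measure on $G$ locally agreeing with it; $m_{\mathcal V}$ a $G$-invariant measure on $\mathcal V$ with $\int_{\Gamma\backslash G}\#(\mathcal Lg\cap B)\,d\mu_\Gamma=m_{\mathcal V}(B)$ for finite-measure Borel $B$. $D(\mathcal Lg,B)=|\#(\mathcal Lg\cap B)-m_{\mathcal V}(B)|$; $\mathcal A_{1,c}$ is the family of finite-measure Borel $B\subseteq\mathcal V$ with $\int_{\Gamma\backslash G}|D(\mathcal Lg,B)|^2d\mu_\Gamma(g)\le 2c\,m_{\mathcal V}(B)$ (i.e. $\le c(m_{\mathcal V}(B)^1+m_{\mathcal V}(B))$). $F_g^{-1}(\Omega)=\{\bm v\in\mathcal V:F(\bm vg)\in\Omega\}$.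
   Formalization: The neighbourhoods O_ε are assumed to be Borel of finite Haar measure; if infinite measure were allowed, the lower bound δ_0 ε^d would be vacuous and the claim false (e.g. O_ε containing a non-compact factor of G that acts trivially). *)

theory Defs
  imports "HOL-Probability.Probability_Measure" "HOL-Algebra.Coset"
begin

section \<open>Real algebraic groups, varieties and actions\<close>

definition GL :: "(real^'n^'n) monoid" where
  "GL = \<lparr>carrier = {A. invertible A}, mult = (**), one = mat 1\<rparr>"

abbreviation subgrp :: "(real^'n^'n) set \<Rightarrow> (real^'n^'n) monoid" where
  "subgrp G \<equiv> GL\<lparr>carrier := G\<rparr>"

definition real_algebraic_group :: "(real^'n^'n) set \<Rightarrow> bool" where
  "real_algebraic_group G \<longleftrightarrow> subgroup G GL \<and>
     (\<exists>P. (\<forall>p\<in>P. real_polynomial_function p) \<and>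
          G = {A \<in> carrier GL. \<forall>p\<in>P. p A = 0})"

text \<open>
  Varieties are Zariski locally closed subsets of affine space. Closed ones are the case where
  \<open>Q\<close> contains a nonzero constant; the open condition admits homogeneous spaces such as the
  punctured space \<open>\<real>\<^sup>N - {0}\<close> or a punctured cone, on which a linear group can act
  transitively.
\<close>
definition algebraic_variety :: "(real^'d) set \<Rightarrow> bool" where
  "algebraic_variety V \<longleftrightarrow>
     (\<exists>P Q. (\<forall>p\<in>P \<union> Q. real_polynomial_function p) \<and>
            V = {v. (\<forall>p\<in>P. p v = 0) \<and> (\<exists>q\<in>Q. q v \<noteq> 0)})"

text \<open>
  On the real points of a quasi-affine variety, local quotients of polynomials glue to a single
  quotient: if \<open>f = p\<^sub>i / q\<^sub>i\<close> wherever \<open>q\<^sub>i \<noteq> 0\<close>, and the \<open>q\<^sub>i\<close> have no common real zero, then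
  \<open>f = (\<Sum>i. p\<^sub>i * q\<^sub>i) / (\<Sum>i. q\<^sub>i\<^sup>2)\<close>.
\<close>
definition regular_map_on :: "'a::real_normed_vector set \<Rightarrow> ('a \<Rightarrow> real^'d) \<Rightarrow> bool" where
  "regular_map_on X f \<longleftrightarrow>
     (\<forall>i. \<exists>p q. real_polynomial_function p \<and> real_polynomial_function q \<and>
                (\<forall>x\<in>X. q x \<noteq> 0 \<and> f x $ i = p x / q x))"

definition algebraic_right_action ::
    "(real^'d) set \<Rightarrow> (real^'n^'n) set \<Rightarrow> (real^'d \<Rightarrow> real^'n^'n \<Rightarrow> real^'d) \<Rightarrow> bool" where
  "algebraic_right_action V G act \<longleftrightarrow>
     (\<forall>v\<in>V. \<forall>g\<in>G. act v g \<in> V) \<and>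
     (\<forall>v\<in>V. act v \<one>\<^bsub>GL\<^esub> = v) \<and>
     (\<forall>v\<in>V. \<forall>g\<in>G. \<forall>h\<in>G. act v (g \<otimes>\<^bsub>GL\<^esub> h) = act (act v g) h) \<and>
     regular_map_on (V \<times> G) (\<lambda>(v, g). act v g)"

definition transitive_right_action ::
    "'v set \<Rightarrow> 'g set \<Rightarrow> ('v \<Rightarrow> 'g \<Rightarrow> 'v) \<Rightarrow> bool" where
  "transitive_right_action V G act \<longleftrightarrow> (\<forall>v\<in>V. \<forall>w\<in>V. \<exists>g\<in>G. act v g = w)"

definition act_set :: "('v \<Rightarrow> 'g \<Rightarrow> 'v) \<Rightarrow> 'v set \<Rightarrow> 'g set \<Rightarrow> 'v set" where
  "act_set act A X = {act v g | v g. v \<in> A \<and> g \<in> X}"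

section \<open>Haar measure and lattices\<close>

definition left_haar_measure :: "(real^'n^'n) set \<Rightarrow> (real^'n^'n) measure \<Rightarrow> bool" where
  "left_haar_measure G \<mu> \<longleftrightarrow>
     sets \<mu> = sets (restrict_space borel G) \<and>
     (\<forall>g\<in>G. \<forall>A\<in>sets \<mu>. emeasure \<mu> (g <#\<^bsub>GL\<^esub> A) = emeasure \<mu> A) \<and>
     (\<forall>K. compact K \<and> K \<subseteq> G \<longrightarrow> emeasure \<mu> K < \<infinity>) \<and>
     emeasure \<mu> G \<noteq> 0"

definition unimodular :: "(real^'n^'n) set \<Rightarrow> bool" where
  "unimodular G \<longleftrightarrow>
     (\<forall>\<mu>. left_haar_measure G \<mu> \<longrightarrow>
        (\<forall>g\<in>G. \<forall>A\<in>sets \<mu>. emeasure \<mu> (A #>\<^bsub>GL\<^esub> g) = emeasure \<mu> A))"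

text \<open>
  The quotient \<open>\<Gamma>\G\<close> is the set \<open>rcosets \<Gamma>\<close> of cosets \<open>\<Gamma>g\<close>. The preimage in \<open>G\<close> of a set \<open>U\<close> of
  cosets is \<open>\<Union>U\<close>, so this is the quotient topology.
\<close>
definition coset_topology ::
    "(real^'n^'n) set \<Rightarrow> (real^'n^'n) set \<Rightarrow> (real^'n^'n) set topology" where
  "coset_topology \<Gamma> G =
     topology (\<lambda>U. U \<subseteq> (rcosets\<^bsub>subgrp G\<^esub> \<Gamma>) \<and> openin (top_of_set G) (\<Union>U))"

lemma group_GL: "group (GL :: (real^'n^'n) monoid)"
proof (rule groupI)
  fix x :: "real^'n^'n"
  assume "x \<in> carrier GL"
  then obtain y where "x ** y = mat 1" "y ** x = mat 1"
    by (auto simp: GL_def invertible_def)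
  then have "y \<in> carrier GL \<and> y \<otimes>\<^bsub>GL\<^esub> x = \<one>\<^bsub>GL\<^esub>"
    by (auto simp: GL_def invertible_def)
  then show "\<exists>y\<in>carrier GL. y \<otimes>\<^bsub>GL\<^esub> x = \<one>\<^bsub>GL\<^esub>"
    by blast
next
  show "\<one>\<^bsub>GL\<^esub> \<in> carrier (GL :: (real^'n^'n) monoid)"
    by (simp add: GL_def invertible_def)
qed (simp_all add: GL_def invertible_mult matrix_mul_assoc)

lemma openin_coset_topology:
  assumes G: "subgroup G GL" and \<Gamma>: "subgroup \<Gamma> (subgrp G)"
  shows "openin (coset_topology \<Gamma> G) U \<longleftrightarrow>
    U \<subseteq> (rcosets\<^bsub>subgrp G\<^esub> \<Gamma>) \<and> openin (top_of_set G) (\<Union>U)"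
proof -
  interpret group "subgrp G"
    using group.subgroup_imp_group[OF group_GL G] .
  have disj: "pairwise disjnt (rcosets\<^bsub>subgrp G\<^esub> \<Gamma>)"
    using rcos_disjoint[OF \<Gamma>] .
  have int: "\<Union>(S \<inter> T) = \<Union>S \<inter> \<Union>T"
    if "S \<subseteq> (rcosets\<^bsub>subgrp G\<^esub> \<Gamma>)" "T \<subseteq> (rcosets\<^bsub>subgrp G\<^esub> \<Gamma>)" for S T
  proof (intro equalityI subsetI)
    fix h assume "h \<in> \<Union>S \<inter> \<Union>T"
    then obtain x y where xy: "x \<in> S" "y \<in> T" "h \<in> x" "h \<in> y"
      by blast
    then have "x = y"
      using that pairwiseD[OF disj, of x y] by (auto simp: disjnt_iff)
    with xy show "h \<in> \<Union>(S \<inter> T)"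
      by blast
  qed blast
  have un: "\<Union>(\<Union>K) = \<Union>(Union ` K)" for K :: "(real^'n^'n) set set set"
    by blast
  have "istopology (\<lambda>U. U \<subseteq> (rcosets\<^bsub>subgrp G\<^esub> \<Gamma>) \<and> openin (top_of_set G) (\<Union>U))"
    unfolding istopology_def
  proof (intro conjI allI impI)
    fix S T
    assume S: "S \<subseteq> (rcosets\<^bsub>subgrp G\<^esub> \<Gamma>) \<and> openin (top_of_set G) (\<Union>S)"
      and T: "T \<subseteq> (rcosets\<^bsub>subgrp G\<^esub> \<Gamma>) \<and> openin (top_of_set G) (\<Union>T)"
    then show "S \<inter> T \<subseteq> (rcosets\<^bsub>subgrp G\<^esub> \<Gamma>)"
      by blast
    show "openin (top_of_set G) (\<Union>(S \<inter> T))"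
      using S T by (simp add: int openin_Int)
  next
    fix K
    assume K: "\<forall>S\<in>K. S \<subseteq> (rcosets\<^bsub>subgrp G\<^esub> \<Gamma>) \<and> openin (top_of_set G) (\<Union>S)"
    then show "\<Union>K \<subseteq> (rcosets\<^bsub>subgrp G\<^esub> \<Gamma>)"
      by (intro Sup_least) simp
    show "openin (top_of_set G) (\<Union>(\<Union>K))"
      unfolding un using K by (intro openin_Union) auto
  qed
  then show ?thesis
    unfolding coset_topology_def by (subst topology_inverse') (assumption, rule refl)
qed

definition invariant_coset_measure ::
    "(real^'n^'n) set \<Rightarrow> (real^'n^'n) set \<Rightarrow> (real^'n^'n) set measure \<Rightarrow> bool" where
  "invariant_coset_measure \<Gamma> G \<mu>q \<longleftrightarrow>
     space \<mu>q = (rcosets\<^bsub>subgrp G\<^esub> \<Gamma>) \<and>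
     sets \<mu>q = sigma_sets (rcosets\<^bsub>subgrp G\<^esub> \<Gamma>) {U. openin (coset_topology \<Gamma> G) U} \<and>
     (\<forall>g\<in>G. \<forall>A\<in>sets \<mu>q. emeasure \<mu>q ((\<lambda>x. x #>\<^bsub>GL\<^esub> g) ` A) = emeasure \<mu>q A)"

definition lattice_in :: "(real^'n^'n) set \<Rightarrow> (real^'n^'n) set \<Rightarrow> bool" where
  "lattice_in \<Gamma> G \<longleftrightarrow> subgroup \<Gamma> (subgrp G) \<and> discrete \<Gamma> \<and>
     (\<exists>\<mu>q. prob_space \<mu>q \<and> invariant_coset_measure \<Gamma> G \<mu>q)"

definition nonuniform_lattice_in :: "(real^'n^'n) set \<Rightarrow> (real^'n^'n) set \<Rightarrow> bool" where
  "nonuniform_lattice_in \<Gamma> G \<longleftrightarrow>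
     lattice_in \<Gamma> G \<and> \<not> compact_space (coset_topology \<Gamma> G)"

definition locally_agrees ::
    "(real^'n^'n) set \<Rightarrow> (real^'n^'n) set \<Rightarrow> (real^'n^'n) set measure \<Rightarrow> (real^'n^'n) measure \<Rightarrow> bool"
  where
  "locally_agrees \<Gamma> G \<mu>q \<mu> \<longleftrightarrow>
     (\<forall>g\<in>G. \<exists>U. openin (top_of_set G) U \<and> g \<in> U \<and> inj_on (\<lambda>h. \<Gamma> #>\<^bsub>GL\<^esub> h) U \<and>
        (\<forall>A\<in>sets \<mu>. A \<subseteq> U \<longrightarrow> emeasure \<mu>q ((\<lambda>h. \<Gamma> #>\<^bsub>GL\<^esub> h) ` A) = emeasure \<mu> A))"

definition identity_nbhd :: "(real^'n^'n) set \<Rightarrow> (real^'n^'n) set \<Rightarrow> bool" where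
  "identity_nbhd G X \<longleftrightarrow> X \<subseteq> G \<and> (\<exists>U. openin (top_of_set G) U \<and> \<one>\<^bsub>GL\<^esub> \<in> U \<and> U \<subseteq> X)"

section \<open>The counting problem\<close>

text \<open>
  Since \<open>L\<gamma> = L\<close> for \<open>\<gamma> \<in> \<Gamma>\<close>, the set \<open>act_set act L x\<close> for a coset \<open>x = \<Gamma>g\<close> is the translate \<open>Lg\<close>;
  integrals over \<open>\<Gamma>\G\<close> of functions of \<open>Lg\<close> are written in this way.
\<close>
locale orbit_counting =
  fixes V :: "(real^'d) set"
    and G :: "(real^'n^'n) set"
    and act :: "real^'d \<Rightarrow> real^'n^'n \<Rightarrow> real^'d"
    and \<Gamma> :: "(real^'n^'n) set"
    and L :: "(real^'d) set"
    and \<mu>q :: "(real^'n^'n) set measure"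
    and \<mu> :: "(real^'n^'n) measure"
    and m :: "(real^'d) measure"
  assumes variety: "algebraic_variety V"
    and group: "real_algebraic_group G" "unimodular G"
    and action: "algebraic_right_action V G act" "transitive_right_action V G act"
    and lattice: "nonuniform_lattice_in \<Gamma> G"
    and points: "L \<subseteq> V" "infinite L" "discrete L" "\<forall>\<gamma>\<in>\<Gamma>. act_set act L {\<gamma>} = L"
    and quotient_measure: "prob_space \<mu>q" "invariant_coset_measure \<Gamma> G \<mu>q"
    and haar: "left_haar_measure G \<mu>" "locally_agrees \<Gamma> G \<mu>q \<mu>"
    and sets_m: "sets m = sets (restrict_space borel V)"
    and invariant_m:
      "\<forall>g\<in>G. \<forall>B\<in>sets m. emeasure m (act_set act B {g}) = emeasure m B"
    and mean_value:
      "\<forall>B\<in>fmeasurable m.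
         (\<integral>\<^sup>+ x. emeasure (count_space UNIV) (act_set act L x \<inter> B) \<partial>\<mu>q) = emeasure m B"

definition discrepancy :: "'v measure \<Rightarrow> 'v set \<Rightarrow> 'v set \<Rightarrow> ennreal" where
  "discrepancy m \<Lambda> B =
     (if finite (\<Lambda> \<inter> B) then ennreal \<bar>real (card (\<Lambda> \<inter> B)) - measure m B\<bar> else \<infinity>)"

text \<open>The family \<open>\<A>\<^bsub>1,c\<^esub>\<close>.\<close>
definition A1 ::
    "('v \<Rightarrow> 'g \<Rightarrow> 'v) \<Rightarrow> 'v set \<Rightarrow> 'g set measure \<Rightarrow> 'v measure \<Rightarrow> real \<Rightarrow> 'v set set" where
  "A1 act L \<mu>q m c =
     {B \<in> fmeasurable m.
        (\<integral>\<^sup>+ x. (discrepancy m (act_set act L x) B)\<^sup>2 \<partial>\<mu>q) \<le> ennreal (2 * c * measure m B)}"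

text \<open>\<open>F_preimage V act F g \<Omega>\<close> is \<open>F\<^sub>g\<^sup>-\<^sup>1(\<Omega>)\<close> where \<open>F\<^sub>g(v) = F(vg)\<close>.\<close>
definition F_preimage ::
    "'v set \<Rightarrow> ('v \<Rightarrow> 'g \<Rightarrow> 'v) \<Rightarrow> ('v \<Rightarrow> 'w) \<Rightarrow> 'g \<Rightarrow> 'w set \<Rightarrow> 'v set" where
  "F_preimage V act F g \<Omega> = {v \<in> V. F (act v g) \<in> \<Omega>}"

end

theory Submission
  imports Defs "HOL-Real_Asymp.Real_Asymp"
begin

text \<open>
  Take \<open>\<nu> < \<nu>' < min \<delta> ((a - b)/(d + 3))\<close>, the times \<open>t\<^sub>k = k\<^bsup>1/\<nu>'\<^esup>\<close> and the scales \<open>\<epsilon>\<^sub>k = 1/k\<close>. Near a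
  given point of \<open>G\<close>, a maximal family of points \<open>q\<close> with disjoint translates \<open>\<O>\<^bsub>1/k\<^esub>q\<close> has \<open>O(k\<^sup>d)\<close>
  members, and every \<open>g\<close> there satisfies \<open>h\<^sub>1g = h\<^sub>2q\<close> for some member \<open>q\<close> and \<open>h\<^sub>1, h\<^sub>2 \<in> \<O>\<^bsub>1/k\<^esub>\<close>.
  For \<open>t\<close> between \<open>t\<^sub>k\<close> and \<open>t\<^bsub>k+1\<^esub>\<close> the count at \<open>g\<close> then lies between counts of \<open>Lg\<close> in sets
  depending only on \<open>q\<close> and \<open>k\<close>, whose measures in turn lie between those of the corresponding sets
  for \<open>g\<close> itself, so that only the volume asymptotics at \<open>g\<close> enter. By Chebyshev's inequality the
  squared discrepancy of such a set \<open>A\<close> exceeds \<open>R m(A)\<close> with probability at most \<open>2c\<^sub>0/R\<close>. With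
  \<open>R = k\<^bsup>(a - b)/\<nu>' - 2\<^esup>\<close>, which makes the relative error \<open>O(1/k)\<close>, the exceptional sets have
  measure \<open>O(k\<^bsup>d + 2 - (a - b)/\<nu>'\<^esup>)\<close>, which is summable, and the Borel-Cantelli lemma applies.
\<close>

section \<open>Asymptotics of the sandwich bounds\<close>

text \<open>In the application \<open>\<alpha>\<close> is \<open>\<beta> * a\<close>,
  \<open>e\<close> is \<open>\<beta> * \<delta>\<close> and \<open>s\<close> is
  \<open>\<beta> * \<nu>\<close>. Since \<open>e > 1\<close>, both \<open>u k - 1\<close> and the
  square root term are O(1/k), while \<open>s < 1\<close> makes the allowed error decay more slowly
  than 1/k.\<close>

lemma upper_factor_eventually:
  fixes a \<alpha> c C e s :: real
  assumes "a > 0" "\<alpha> > 0" "e > 1" "0 < s" "s < 1" "C > 0" "c > 0"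
  defines "u \<equiv> \<lambda>k. ((real k + 1) / real k) powr \<alpha> * ((real k + 1) / (real k - 1)) powr (2 * a)
    * (1 + C * real k powr (- e))"
  shows "\<forall>\<^sub>F k in sequentially. u k + sqrt (u k / c) / real k \<le> 1 + (real k + 1) powr (- s)"
  using assms(1-7) unfolding u_def by real_asymp

text \<open>Again all losses are O(1/k). The extra power \<open>2 * \<delta>\<close> comes from an
  inner radius divided by the square of (k+1)/(k-1), which enlarges its error term. The root keeps
  the upper factor \<open>u\<close>, because the fluctuation is measured by the larger mass.\<close>

lemma lower_factor_eventually:
  fixes a \<alpha> c C e s \<delta> :: real
  assumes "a > 0" "\<alpha> > 0" "e > 1" "0 < s" "s < 1" "C > 0" "c > 0"
  defines "u \<equiv> \<lambda>k. ((real k + 1) / real k) powr \<alpha> * ((real k + 1) / (real k - 1)) powr (2 * a)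
    * (1 + C * real k powr (- e))"
    and "l \<equiv> \<lambda>k. (real k / (real k + 1)) powr \<alpha> * ((real k - 1) / (real k + 1)) powr (2 * a)
    * (1 - C * (real k powr (- e) * ((real k + 1) / (real k - 1)) powr (2 * \<delta>)))"
  shows "\<forall>\<^sub>F k in sequentially. l k - sqrt (u k / c) / real k \<ge> 1 - (real k + 1) powr (- s)"
  using assms(1-7) unfolding u_def l_def by real_asymp

text \<open>\<open>mp\<close> and \<open>mm\<close> stand for an outer and an inner measure at the
  same group element, with target index and radius taken at opposite ends of the block from
  k^\<beta> to (k+1)^\<beta>. Divided by the main term c t^(a-b), they are at most \<open>u\<close>
  and at least \<open>l\<close>.\<close>

lemma counting_sandwich_pos:
  fixes a b c C \<beta> \<delta> \<nu> :: real
  assumes ab: "0 < b" "b < a" and \<beta>: "\<beta> > 0" "\<beta> * \<delta> > 1" "\<nu> > 0" "\<beta> * \<nu> < 1"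
    and C: "C > 0" and c: "c > 0" and k: "k \<ge> (2::nat)"
    and t: "real k powr \<beta> \<le> t" "t \<le> (real k + 1) powr \<beta>"
  defines "\<rho> \<equiv> (real k + 1) / (real k - 1)"
  defines "u \<equiv> ((real k + 1) / real k) powr (\<beta> * a) * \<rho> powr (2 * a)
      * (1 + C * real k powr (- (\<beta> * \<delta>)))"
    and "l \<equiv> (real k / (real k + 1)) powr (\<beta> * a) * ((real k - 1) / (real k + 1)) powr (2 * a)
      * (1 - C * (real k powr (- (\<beta> * \<delta>)) * \<rho> powr (2 * \<delta>)))"
  assumes pos: "1 - C * (real k powr (- (\<beta> * \<delta>)) * \<rho> powr (2 * \<delta>)) > 0"
    and upper: "u + sqrt (u / c) / real k \<le> 1 + (real k + 1) powr (- (\<beta> * \<nu>))"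
    and lower: "l - sqrt (u / c) / real k \<ge> 1 - (real k + 1) powr (- (\<beta> * \<nu>))"
    and mp: "mp = c * (real k powr \<beta>) powr (- b) * ((real k + 1) powr \<beta> * \<rho>\<^sup>2) powr a * (1 + \<theta>\<^sub>1)"
      "\<bar>\<theta>\<^sub>1\<bar> \<le> C * ((real k + 1) powr \<beta> * \<rho>\<^sup>2) powr (- \<delta>)" "mp \<ge> 0"
    and mm: "mm = c * ((real k + 1) powr \<beta>) powr (- b) * (real k powr \<beta> / \<rho>\<^sup>2) powr a * (1 + \<theta>\<^sub>2)"
      "\<bar>\<theta>\<^sub>2\<bar> \<le> C * (real k powr \<beta> / \<rho>\<^sup>2) powr (- \<delta>)"
    and N: "N \<le> mp + sqrt (real k powr (\<beta> * (a - b) - 2) * mp)"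
      "N \<ge> mm - sqrt (real k powr (\<beta> * (a - b) - 2) * mp)"
  shows "\<bar>N / (c * t powr (a - b)) - 1\<bar> \<le> t powr (- \<nu>)"
proof -
  define \<tau> where "\<tau> = c * t powr (a - b)"
  have k1: "real k > 1" and \<rho>: "\<rho> > 1"
    using k by (auto simp: \<rho>_def field_simps)
  then have kp: "real k powr \<beta> > 0" "(real k + 1) powr \<beta> > 0"
    by auto
  then have t0: "t > 0"
    using t by linarith
  then have \<tau>: "\<tau> > 0"
    using c by (simp add: \<tau>_def)
  have \<delta>: "\<delta> > 0"
    using \<beta> by (smt (verit) mult_nonneg_nonpos)
  have \<rho>2: "\<rho>\<^sup>2 powr x = \<rho> powr (2 * x)" for x
    using \<rho> by (simp add: powr_powr flip: powr_numeral)
  have \<theta>1: "1 + \<theta>\<^sub>1 \<le> 1 + C * real k powr (- (\<beta> * \<delta>))"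
  proof -
    have "real k powr \<beta> \<le> (real k + 1) powr \<beta> * \<rho>\<^sup>2"
      using powr_mono2[of \<beta> "real k" "real k + 1"] \<beta> \<rho> one_le_power[of \<rho> 2]
        mult_mono[of "real k powr \<beta>" "(real k + 1) powr \<beta>" 1 "\<rho>\<^sup>2"] kp by auto
    then have "((real k + 1) powr \<beta> * \<rho>\<^sup>2) powr (- \<delta>) \<le> (real k powr \<beta>) powr (- \<delta>)"
      using kp \<delta> by (intro powr_mono2') auto
    then have "C * ((real k + 1) powr \<beta> * \<rho>\<^sup>2) powr (- \<delta>) \<le> C * real k powr (- (\<beta> * \<delta>))"
      using C by (simp add: powr_powr)
    then show ?thesis
      using mp(2) by linarith
  qed
  have mp_le: "mp \<le> \<tau> * u"
  proof -
    have "mp \<le> c * (real k powr \<beta>) powr (- b) * ((real k + 1) powr \<beta> * \<rho>\<^sup>2) powr a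
        * (1 + C * real k powr (- (\<beta> * \<delta>)))"
      unfolding mp(1) using \<theta>1 c by (intro mult_left_mono) auto
    also have "\<dots> = c * (real k powr \<beta>) powr (a - b) * u"
      using k1 kp \<rho> by (simp add: u_def powr_mult powr_divide \<rho>2 powr_powr powr_diff powr_minus
          right_diff_distrib field_simps)
    also have "\<dots> \<le> \<tau> * u"
      unfolding \<tau>_def using t ab c C kp
      by (intro mult_right_mono mult_left_mono powr_mono2) (auto simp: u_def)
    finally show ?thesis .
  qed
  have \<theta>2: "1 + \<theta>\<^sub>2 \<ge> 1 - C * (real k powr (- (\<beta> * \<delta>)) * \<rho> powr (2 * \<delta>))"
  proof -
    have "(real k powr \<beta> / \<rho>\<^sup>2) powr (- \<delta>) = real k powr (- (\<beta> * \<delta>)) * \<rho> powr (2 * \<delta>)"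
      using k1 kp \<rho> by (simp add: powr_divide \<rho>2 powr_powr powr_minus field_simps)
    then show ?thesis
      using mm(2) by simp
  qed
  have mm_ge: "\<tau> * l \<le> mm"
  proof -
    \<comment> \<open>By \<open>pos\<close> the factor \<open>l\<close> is nonnegative, so replacing
      \<open>t\<close> by the right end of the block goes in the required direction.\<close>
    have "\<tau> * l \<le> c * ((real k + 1) powr \<beta>) powr (a - b) * l"
      unfolding \<tau>_def using t ab c pos k1 t0
      by (intro mult_right_mono mult_left_mono powr_mono2) (auto simp: l_def)
    also have "\<dots> = c * ((real k + 1) powr \<beta>) powr (- b) * (real k powr \<beta> / \<rho>\<^sup>2) powr a
        * (1 - C * (real k powr (- (\<beta> * \<delta>)) * \<rho> powr (2 * \<delta>)))"
    proof -
      have "((real k - 1) / (real k + 1)) powr (2 * a) = inverse (\<rho> powr (2 * a))"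
        using k1 by (simp add: \<rho>_def powr_divide field_simps)
      then show ?thesis
        using k1 kp \<rho> by (simp add: l_def powr_mult powr_divide \<rho>2 powr_powr powr_diff powr_minus
          right_diff_distrib field_simps)
    qed
    also have "\<dots> \<le> mm"
      unfolding mm(1) using \<theta>2 c by (intro mult_left_mono) auto
    finally show ?thesis .
  qed
  \<comment> \<open>The exponent -2 in the Chebyshev threshold becomes the factor 1/k after the
    square root, which makes the fluctuation O(1/k) relative to \<open>\<tau>\<close>.\<close>
  have "sqrt (real k powr (\<beta> * (a - b) - 2) * mp) \<le> \<tau> * (sqrt (u / c) / real k)"
  proof (rule real_le_lsqrt)
    have "real k powr (\<beta> * (a - b) - 2) = (real k powr \<beta>) powr (a - b) / (real k)\<^sup>2"
      using k1 by (simp add: powr_diff powr_powr right_diff_distrib)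
    also have "\<dots> \<le> t powr (a - b) / (real k)\<^sup>2"
      using t ab kp by (intro divide_right_mono powr_mono2) auto
    finally have "real k powr (\<beta> * (a - b) - 2) * mp \<le> t powr (a - b) / (real k)\<^sup>2 * (\<tau> * u)"
      using mp(3) mp_le by (intro mult_mono) auto
    also have "\<dots> = (\<tau> * (sqrt (u / c) / real k))\<^sup>2"
    proof -
      have "u \<ge> 0"
        using C by (simp add: u_def)
      then show ?thesis
        using c by (simp add: \<tau>_def power_mult_distrib power_divide) (simp add: power2_eq_square)
    qed
    finally show "real k powr (\<beta> * (a - b) - 2) * mp \<le> (\<tau> * (sqrt (u / c) / real k))\<^sup>2" .
  qed (use \<tau> c C in \<open>auto simp: u_def\<close>)
  then have "N \<le> \<tau> * (u + sqrt (u / c) / real k)" "N \<ge> \<tau> * (l - sqrt (u / c) / real k)"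
    using N mp_le mm_ge by (auto simp: algebra_simps)
  then have "N / \<tau> \<le> u + sqrt (u / c) / real k" "N / \<tau> \<ge> l - sqrt (u / c) / real k"
    using \<tau> by (auto simp: field_simps)
  moreover have "(real k + 1) powr (- (\<beta> * \<nu>)) \<le> t powr (- \<nu>)"
  proof -
    have "((real k + 1) powr \<beta>) powr (- \<nu>) \<le> t powr (- \<nu>)"
      using t t0 \<beta> by (intro powr_mono2') auto
    then show ?thesis
      by (simp add: powr_powr)
  qed
  ultimately have "\<bar>N / \<tau> - 1\<bar> \<le> t powr (- \<nu>)"
    using upper lower by linarith
  then show ?thesis
    by (simp add: \<tau>_def)
qed

text \<open>The threshold for \<open>k\<close> is chosen before \<open>t\<close>, \<open>N\<close>
  and the measures, so it depends on the group element only through \<open>c\<close> and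
  \<open>C\<close>. Neither constant has a prescribed sign: \<open>C\<close> is replaced by a
  positive majorant, and c <= 0 is handled separately.\<close>

lemma counting_sandwich:
  fixes a b c C \<beta> \<delta> \<nu> :: real
  assumes ab: "0 < b" "b < a" and \<beta>: "\<beta> > 0" "\<beta> * \<delta> > 1" "\<nu> > 0" "\<beta> * \<nu> < 1"
  shows "\<forall>\<^sub>F k in sequentially. \<forall>t N mp mm \<theta>\<^sub>1 \<theta>\<^sub>2.
    let \<rho> = (real k + 1) / (real k - 1) in
      real k powr \<beta> \<le> t \<longrightarrow> t \<le> (real k + 1) powr \<beta> \<longrightarrow>
      mp = c * (real k powr \<beta>) powr (- b) * ((real k + 1) powr \<beta> * \<rho>\<^sup>2) powr a * (1 + \<theta>\<^sub>1) \<longrightarrow>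
      \<bar>\<theta>\<^sub>1\<bar> \<le> C * ((real k + 1) powr \<beta> * \<rho>\<^sup>2) powr (- \<delta>) \<longrightarrow> mp \<ge> 0 \<longrightarrow>
      mm = c * ((real k + 1) powr \<beta>) powr (- b) * (real k powr \<beta> / \<rho>\<^sup>2) powr a * (1 + \<theta>\<^sub>2) \<longrightarrow>
      \<bar>\<theta>\<^sub>2\<bar> \<le> C * (real k powr \<beta> / \<rho>\<^sup>2) powr (- \<delta>) \<longrightarrow> mm \<ge> 0 \<longrightarrow>
      N \<le> mp + sqrt (real k powr (\<beta> * (a - b) - 2) * mp) \<longrightarrow>
      N \<ge> mm - sqrt (real k powr (\<beta> * (a - b) - 2) * mp) \<longrightarrow>
      (\<exists>\<theta>. \<bar>\<theta>\<bar> \<le> t powr (- \<nu>) \<and> N = c * t powr (a - b) * (1 + \<theta>))"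
proof -
  define C' where "C' = \<bar>C\<bar> + 1"
  have C': "C' > 0" "C \<le> C'"
    by (auto simp: C'_def)
  have s: "0 < \<beta> * \<nu>" "0 < \<beta> * a" "0 < a"
    using \<beta> ab by auto
  have pos: "\<forall>\<^sub>F k in sequentially.
      1 - C' * (real k powr (- (\<beta> * \<delta>)) * ((real k + 1) / (real k - 1)) powr (2 * \<delta>)) > 0"
    using \<beta>(2) C' by real_asymp
  show ?thesis
  proof (cases "c > 0")
    case True
    show ?thesis
      using pos eventually_ge_at_top[of 2]
        upper_factor_eventually[OF s(3,2) \<beta>(2) s(1) \<beta>(4) C'(1) True]
        lower_factor_eventually[OF s(3,2) \<beta>(2) s(1) \<beta>(4) C'(1) True, of \<delta>]
    proof eventually_elim
      case (elim k)
      show ?case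
        unfolding Let_def
      proof (intro allI impI)
        fix t N mp mm \<theta>\<^sub>1 \<theta>\<^sub>2 :: real
        let ?\<rho> = "(real k + 1) / (real k - 1)"
        assume t: "real k powr \<beta> \<le> t" "t \<le> (real k + 1) powr \<beta>"
          and mp: "mp = c * (real k powr \<beta>) powr (- b) * ((real k + 1) powr \<beta> * ?\<rho>\<^sup>2) powr a * (1 + \<theta>\<^sub>1)"
            "\<bar>\<theta>\<^sub>1\<bar> \<le> C * ((real k + 1) powr \<beta> * ?\<rho>\<^sup>2) powr (- \<delta>)" "mp \<ge> 0"
          and mm: "mm = c * ((real k + 1) powr \<beta>) powr (- b) * (real k powr \<beta> / ?\<rho>\<^sup>2) powr a * (1 + \<theta>\<^sub>2)"
            "\<bar>\<theta>\<^sub>2\<bar> \<le> C * (real k powr \<beta> / ?\<rho>\<^sup>2) powr (- \<delta>)" "mm \<ge> 0"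
          and N: "N \<le> mp + sqrt (real k powr (\<beta> * (a - b) - 2) * mp)"
            "N \<ge> mm - sqrt (real k powr (\<beta> * (a - b) - 2) * mp)"
        have 1: "\<bar>\<theta>\<^sub>1\<bar> \<le> C' * ((real k + 1) powr \<beta> * ?\<rho>\<^sup>2) powr (- \<delta>)"
          using mp(2) mult_right_mono[OF C'(2) powr_ge_zero] order_trans by blast
        have 2: "\<bar>\<theta>\<^sub>2\<bar> \<le> C' * (real k powr \<beta> / ?\<rho>\<^sup>2) powr (- \<delta>)"
          using mm(2) mult_right_mono[OF C'(2) powr_ge_zero] order_trans by blast
        have le: "\<bar>N / (c * t powr (a - b)) - 1\<bar> \<le> t powr (- \<nu>)"
          by (rule counting_sandwich_pos[OF ab \<beta> C'(1) True elim(2) t elim(1,3,4) mp(1) 1 mp(3)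
                mm(1) 2 N])
        have "t > 0"
          using t(1) elim(2) by (smt (verit) of_nat_0_less_iff pos2 powr_gt_zero order.strict_trans2)
        then have "N = c * t powr (a - b) * (1 + (N / (c * t powr (a - b)) - 1))"
          using True by simp
        with le show "\<exists>\<theta>. \<bar>\<theta>\<bar> \<le> t powr (- \<nu>) \<and> N = c * t powr (a - b) * (1 + \<theta>)"
          by blast
      qed
    qed
  next
    case False
    show ?thesis
      using pos eventually_ge_at_top[of 2]
    proof eventually_elim
      case (elim k)
      show ?case
        unfolding Let_def
      proof (intro allI impI)
        fix t N mp mm \<theta>\<^sub>1 \<theta>\<^sub>2 :: real
        define \<rho> where "\<rho> = (real k + 1) / (real k - 1)"
        assume "mp = c * (real k powr \<beta>) powr (- b) * ((real k + 1) powr \<beta> * ((real k + 1) / (real k - 1))\<^sup>2) powr a * (1 + \<theta>\<^sub>1)"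
          and mm: "mm = c * ((real k + 1) powr \<beta>) powr (- b) * (real k powr \<beta> / ((real k + 1) / (real k - 1))\<^sup>2) powr a * (1 + \<theta>\<^sub>2)"
            "\<bar>\<theta>\<^sub>2\<bar> \<le> C * (real k powr \<beta> / ((real k + 1) / (real k - 1))\<^sup>2) powr (- \<delta>)" "mm \<ge> 0"
          and N: "N \<le> mp + sqrt (real k powr (\<beta> * (a - b) - 2) * mp)"
            "N \<ge> mm - sqrt (real k powr (\<beta> * (a - b) - 2) * mp)"
        \<comment> \<open>For large k the factor \<open>1 + \<theta>\<^sub>2\<close> is positive, so
          \<open>mm \<ge> 0\<close> rules out c < 0. With c = 0 both measures vanish and the two
          bounds force \<open>N = 0\<close>.\<close>
        moreover have "c = 0"
        proof -
          have k: "real k > 1" "\<rho> > 0"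
            using elim(2) by (auto simp: \<rho>_def)
          have "(real k powr \<beta> / \<rho>\<^sup>2) powr (- \<delta>) = real k powr (- (\<beta> * \<delta>)) * \<rho> powr (2 * \<delta>)"
            using k by (simp add: powr_divide powr_powr powr_minus field_simps flip: powr_numeral)
          then have "\<bar>\<theta>\<^sub>2\<bar> \<le> C' * (real k powr (- (\<beta> * \<delta>)) * \<rho> powr (2 * \<delta>))"
            using mm(2) mult_right_mono[OF C'(2) powr_ge_zero] order_trans unfolding \<rho>_def by metis
          then have "1 + \<theta>\<^sub>2 > 0"
            using elim(1) unfolding \<rho>_def[symmetric] by linarith
          moreover have "((real k + 1) powr \<beta>) powr (- b) > 0" "(real k powr \<beta> / \<rho>\<^sup>2) powr a > 0"
            using k by auto
          ultimately show "c = 0"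
            using mm(1,3) False unfolding \<rho>_def[symmetric]
            by (auto simp: zero_le_mult_iff)
        qed
        ultimately have "N = c * t powr (a - b) * (1 + 0)"
          by auto
        then show "\<exists>\<theta>. \<bar>\<theta>\<bar> \<le> t powr (- \<nu>) \<and> N = c * t powr (a - b) * (1 + \<theta>)"
          by (intro exI[of _ 0]) auto
      qed
    qed
  qed
qed

section \<open>Topological preliminaries\<close>

lemma continuous_on_matrix_mult_right: "continuous_on S (\<lambda>g. g ** A)" for A :: "real^'n^'n"
  unfolding matrix_matrix_mult_def by (intro continuous_intros)

text \<open>Singletons are relatively open, and Lindelof's theorem extracts countably many of them
  with the same union.\<close>

lemma countable_discrete:
  fixes S :: "'a::second_countable_topology set"
  assumes "discrete S"
  shows "countable S"
proof -
  have "\<And>T. T \<in> (\<lambda>x. {x}) ` S \<Longrightarrow> openin (top_of_set S) T"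
    using assms by (fastforce simp: discrete_def isolated_in_def openin_open Int_commute)
  then obtain \<F> where \<F>: "\<F> \<subseteq> (\<lambda>x. {x}) ` S" "countable \<F>" "\<Union>\<F> = \<Union>((\<lambda>x. {x}) ` S)"
    by (rule Lindelof_openin)
  have "countable (\<Union>T\<in>\<F>. T)"
  proof (rule countable_UN[OF \<F>(2)])
    fix T assume "T \<in> \<F>"
    then obtain x where "T = {x}"
      using \<F>(1) by blast
    then show "countable T"
      by simp
  qed
  then show ?thesis
    using \<F>(3) by simp
qed

lemma continuous_on_regular_map:
  fixes f :: "'a::real_normed_vector \<Rightarrow> real^'d"
  assumes "regular_map_on X f"
  shows "continuous_on X f"
proof -
  have "continuous_on X (\<lambda>x. f x $ i)" for i
  proof -
    obtain p q where pq: "real_polynomial_function p" "real_polynomial_function q"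
      "\<And>x. x \<in> X \<Longrightarrow> q x \<noteq> 0 \<and> f x $ i = p x / q x"
      using assms unfolding regular_map_on_def by metis
    have "continuous_on X (\<lambda>x. p x / q x)"
      using pq continuous_real_polymonial_function
      by (intro continuous_on_divide continuous_at_imp_continuous_on) auto
    then show ?thesis
      using pq(3) by (subst continuous_on_cong[OF refl]) auto
  qed
  then have "continuous_on X (\<lambda>x. \<chi> i. f x $ i)"
    by (rule continuous_on_vec_lambda)
  then show ?thesis
    by simp
qed

section \<open>The action and its exceptional sets\<close>

context orbit_counting
begin

section \<open>Group identities, continuity of the action and invariance of the measures\<close>

lemma subgroup_G: "subgroup G GL"
  using group(1) by (simp add: real_algebraic_group_def)

lemma mult_closed: "g \<in> G \<Longrightarrow> h \<in> G \<Longrightarrow> g ** h \<in> G"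
  using subgroup.m_closed[OF subgroup_G] by (simp add: GL_def)

lemma one_closed: "mat 1 \<in> G"
  using subgroup.one_closed[OF subgroup_G] by (simp add: GL_def)

lemma inverse_ex:
  assumes "g \<in> G"
  obtains h where "h \<in> G" "g ** h = mat 1" "h ** g = mat 1"
proof -
  interpret GL: group GL
    by (rule group_GL)
  have g: "g \<in> carrier GL"
    using subgroup.mem_carrier[OF subgroup_G assms] .
  show ?thesis
    using subgroup.m_inv_closed[OF subgroup_G assms] GL.l_inv[OF g] GL.r_inv[OF g] that
    by (simp add: GL_def)
qed

lemma act_closed: "v \<in> V \<Longrightarrow> g \<in> G \<Longrightarrow> act v g \<in> V"
  using action(1) by (simp add: algebraic_right_action_def)

lemma act_one: "v \<in> V \<Longrightarrow> act v (mat 1) = v"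
  using action(1) by (simp add: algebraic_right_action_def GL_def)

lemma act_mult: "v \<in> V \<Longrightarrow> g \<in> G \<Longrightarrow> h \<in> G \<Longrightarrow> act v (g ** h) = act (act v g) h"
  using action(1) by (simp add: algebraic_right_action_def GL_def)

lemma inj_on_act:
  assumes "g \<in> G"
  shows "inj_on (\<lambda>v. act v g) V"
proof (rule inj_onI)
  fix v w assume vw: "v \<in> V" "w \<in> V" "act v g = act w g"
  obtain h where "h \<in> G" "g ** h = mat 1"
    using inverse_ex[OF assms] by blast
  then show "v = w"
    using vw assms act_mult act_one by metis
qed

lemma space_\<mu>: "space \<mu> = G"
  using haar(1) sets_eq_imp_space_eq[of \<mu> "restrict_space borel G"]
  by (simp add: left_haar_measure_def space_restrict_space)

lemma sets_\<mu>: "sets \<mu> = sets (restrict_space borel G)"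
  using haar(1) by (simp add: left_haar_measure_def)

lemma space_m: "space m = V"
  using sets_eq_imp_space_eq[OF sets_m] by (simp add: space_restrict_space)

lemma continuous_on_act: "continuous_on (V \<times> G) (\<lambda>(v, g). act v g)"
  using action(1) continuous_on_regular_map by (auto simp: algebraic_right_action_def)

lemma measurable_act_group:
  assumes "v \<in> V"
  shows "(\<lambda>g. act v g) \<in> measurable \<mu> m"
proof -
  have "continuous_on G (\<lambda>g. (\<lambda>(v, g). act v g) (v, g))"
    using assms by (intro continuous_on_compose2[OF continuous_on_act] continuous_intros) auto
  then have "(\<lambda>g. act v g) \<in> measurable (restrict_space borel G) (restrict_space borel V)"
    using assms act_closed
    by (intro measurable_restrict_space2 borel_measurable_continuous_on_restrict)
      (auto simp: space_restrict_space)
  then show ?thesis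
    by (simp add: measurable_cong_sets[OF sets_\<mu> sets_m])
qed

lemma measurable_act_point:
  assumes "g \<in> G"
  shows "(\<lambda>v. act v g) \<in> measurable m m"
proof -
  have "continuous_on V (\<lambda>v. (\<lambda>(v, g). act v g) (v, g))"
    using assms by (intro continuous_on_compose2[OF continuous_on_act] continuous_intros) auto
  then have "(\<lambda>v. act v g) \<in> measurable (restrict_space borel V) (restrict_space borel V)"
    using assms act_closed
    by (intro measurable_restrict_space2 borel_measurable_continuous_on_restrict)
      (auto simp: space_restrict_space)
  then show ?thesis
    by (simp add: measurable_cong_sets[OF sets_m sets_m])
qed

lemma sets_act_set:
  assumes A: "A \<in> sets m" and g: "g \<in> G"
  shows "act_set act A {g} \<in> sets m"
proof -
  obtain h where h: "h \<in> G" "g ** h = mat 1" "h ** g = mat 1"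
    using inverse_ex[OF g] by blast
  have AV: "A \<subseteq> V"
    using sets.sets_into_space[OF A] space_m by simp
  \<comment> \<open>The image under \<open>g\<close> is the preimage under its inverse
    \<open>h\<close>, so measurability of the action suffices.\<close>
  have "act_set act A {g} = (\<lambda>v. act v h) -` A \<inter> space m"
  proof (intro equalityI subsetI)
    fix w assume "w \<in> act_set act A {g}"
    then obtain v where v: "v \<in> A" "w = act v g"
      by (auto simp: act_set_def)
    then have "act w h = v"
      using AV g h act_mult act_one by (metis subsetD)
    then show "w \<in> (\<lambda>v. act v h) -` A \<inter> space m"
      using v AV g act_closed by (auto simp: space_m)
  next
    fix w assume w: "w \<in> (\<lambda>v. act v h) -` A \<inter> space m"
    then have "act (act w h) g = w"
      using g h act_mult act_one space_m by (metis IntD2)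
    then show "w \<in> act_set act A {g}"
      using w by (force simp: act_set_def)
  qed
  then show ?thesis
    using measurable_sets[OF measurable_act_point[OF h(1)] A] by simp
qed

lemma fmeasurable_act_set:
  assumes A: "A \<in> fmeasurable m" and g: "g \<in> G"
  shows "act_set act A {g} \<in> fmeasurable m" "measure m (act_set act A {g}) = measure m A"
proof -
  have eq: "emeasure m (act_set act A {g}) = emeasure m A"
    using invariant_m A g by blast
  then show "act_set act A {g} \<in> fmeasurable m"
    using sets_act_set[of A g] A g by (auto simp: fmeasurable_def)
  show "measure m (act_set act A {g}) = measure m A"
    by (simp add: measure_def eq)
qed

text \<open>Unimodularity gives equality of the values before the translate is known to be
  measurable. As \<open>emeasure\<close> is 0 on nonmeasurable sets, positivity of the measure of
  \<open>A\<close> then yields measurability.\<close>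

lemma right_translate:
  assumes A: "A \<in> fmeasurable \<mu>" "measure \<mu> A > 0" and g: "g \<in> G"
  shows "A #>\<^bsub>GL\<^esub> g \<in> fmeasurable \<mu>" "measure \<mu> (A #>\<^bsub>GL\<^esub> g) = measure \<mu> A"
proof -
  have eq: "emeasure \<mu> (A #>\<^bsub>GL\<^esub> g) = emeasure \<mu> A"
    using group(2) haar(1) A g by (auto simp: unimodular_def)
  moreover have "emeasure \<mu> A \<noteq> 0"
    using A(2) by (auto simp: measure_def)
  ultimately have "A #>\<^bsub>GL\<^esub> g \<in> sets \<mu>"
    using emeasure_neq_0_sets by metis
  then show "A #>\<^bsub>GL\<^esub> g \<in> fmeasurable \<mu>"
    using A(1) eq by (auto simp: fmeasurable_def)
  show "measure \<mu> (A #>\<^bsub>GL\<^esub> g) = measure \<mu> A"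
    by (simp add: measure_def eq)
qed

section \<open>Point counts as functions on G and their exceptional sets\<close>

text \<open>The points of Lh in \<open>A\<close> are indexed by their preimages in \<open>L\<close>,
  so that \<open>h\<close> enters only through countably many conditions, one for each lattice
  point.\<close>

definition hits :: "(real^'d) set \<Rightarrow> real^'n^'n \<Rightarrow> (real^'d) set" where
  "hits A h = {v \<in> L. act v h \<in> A}"

lemma countable_L: "countable L"
  using points(3) by (rule countable_discrete)

lemma lattice_subset: "\<Gamma> \<subseteq> G"
proof -
  have "subgroup \<Gamma> (subgrp G)"
    using lattice by (simp add: nonuniform_lattice_in_def lattice_in_def)
  then show ?thesis
    using subgroup.subset by fastforce
qed

text \<open>Invariance of \<open>L\<close> under \<open>\<Gamma>\<close> collapses the coset to the
  single translate by \<open>h\<close>; the identity of \<open>\<Gamma>\<close> gives the reverse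
  inclusion.\<close>

lemma act_set_coset:
  assumes h: "h \<in> G"
  shows "act_set act L (\<Gamma> #>\<^bsub>GL\<^esub> h) \<inter> A = (\<lambda>v. act v h) ` hits A h"
proof -
  have 1: "act v (\<gamma> ** h) \<in> (\<lambda>v. act v h) ` L" if "v \<in> L" "\<gamma> \<in> \<Gamma>" for v \<gamma>
  proof -
    have "act v \<gamma> \<in> L"
      using points(4) that by (force simp: act_set_def)
    then show ?thesis
      using act_mult[of v \<gamma> h] that points(1) lattice_subset h by auto
  qed
  have "subgroup \<Gamma> (subgrp G)"
    using lattice by (simp add: nonuniform_lattice_in_def lattice_in_def)
  then have "mat 1 \<in> \<Gamma>"
    using subgroup.one_closed by (fastforce simp: GL_def)
  then have "act v h \<in> act_set act L (\<Gamma> #>\<^bsub>GL\<^esub> h)" if "v \<in> L" for v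
    using that by (force simp: act_set_def r_coset_def GL_def)
  moreover have "act_set act L (\<Gamma> #>\<^bsub>GL\<^esub> h) \<subseteq> (\<lambda>v. act v h) ` L"
    using 1 by (auto simp: act_set_def r_coset_def GL_def)
  ultimately show ?thesis
    by (auto simp: hits_def)
qed

lemma inj_on_hits: "h \<in> G \<Longrightarrow> inj_on (\<lambda>v. act v h) (hits A h)"
  by (rule inj_on_subset[OF inj_on_act]) (use points(1) in \<open>auto simp: hits_def\<close>)

lemma discrepancy_coset:
  assumes "h \<in> G"
  shows "discrepancy m (act_set act L (\<Gamma> #>\<^bsub>GL\<^esub> h)) A =
    (if finite (hits A h) then ennreal \<bar>real (card (hits A h)) - measure m A\<bar> else \<infinity>)"
  unfolding discrepancy_def act_set_coset[OF assms]
  using inj_on_hits[OF assms] by (simp add: finite_image_iff card_image)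

lemma sets_hits_eq:
  assumes A: "A \<in> sets m"
  shows "{h \<in> G. hits A h = S} \<in> sets \<mu>"
proof (cases "S \<subseteq> L")
  case True
  have "{h \<in> space \<mu>. \<forall>v\<in>L. act v h \<in> A \<longleftrightarrow> v \<in> S} \<in> sets \<mu>"
  proof (rule sets.sets_Collect_countable_All'[OF _ countable_L])
    fix v assume "v \<in> L"
    then have [measurable]: "(\<lambda>g. act v g) \<in> measurable \<mu> m"
      using points(1) measurable_act_group by auto
    note A[measurable]
    show "{h \<in> space \<mu>. act v h \<in> A \<longleftrightarrow> v \<in> S} \<in> sets \<mu>"
      by measurable
  qed
  also have "{h \<in> space \<mu>. \<forall>v\<in>L. act v h \<in> A \<longleftrightarrow> v \<in> S} = {h \<in> G. hits A h = S}"
    using True by (auto simp: hits_def space_\<mu>)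
  finally show ?thesis .
next
  case False
  then have "{h \<in> G. hits A h = S} = {}"
    by (auto simp: hits_def)
  then show ?thesis
    by (metis sets.empty_sets)
qed

text \<open>The exceptional set of Chebyshev's inequality. Infinite counts are included explicitly
  because \<open>card\<close> is 0 on infinite sets.\<close>

definition irregular :: "(real^'d) set \<Rightarrow> real \<Rightarrow> (real^'n^'n) set" where
  "irregular A R = {h \<in> G. \<not> (finite (hits A h) \<and>
     (real (card (hits A h)) - measure m A)\<^sup>2 \<le> R * measure m A)}"

text \<open>The complement splits according to the exact set of hits, and \<open>L\<close> has only
  countably many finite subsets.\<close>

lemma sets_irregular:
  assumes "A \<in> sets m"
  shows "irregular A R \<in> sets \<mu>"
proof -
  define \<S> where "\<S> = {S. finite S \<and> S \<subseteq> L \<and> (real (card S) - measure m A)\<^sup>2 \<le> R * measure m A}"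
  have "countable \<S>"
    by (rule countable_subset[OF _ countable_Collect_finite_subset[OF countable_L]])
      (auto simp: \<S>_def)
  then have "(\<Union>S\<in>\<S>. {h \<in> G. hits A h = S}) \<in> sets \<mu>"
    using sets_hits_eq[OF assms] by auto
  moreover have "irregular A R = space \<mu> - (\<Union>S\<in>\<S>. {h \<in> G. hits A h = S})"
    by (auto simp: irregular_def \<S>_def space_\<mu> hits_def)
  ultimately show ?thesis
    by auto
qed

text \<open>
  The integrand of the second moment need not be known to be measurable on \<open>\<Gamma>\G\<close>: a null set of
  exceptional \<open>h\<close> needs no estimate, and otherwise its image has nonzero measure and is
  therefore measurable. The case \<open>m(A) = 0\<close> uses that the squared discrepancy is then an integer.
\<close>
lemma emeasure_irregular:
  assumes A: "A \<in> A1 act L \<mu>q m c\<^sub>0" and c0: "c\<^sub>0 > 0" and R: "R > 0"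
    and U: "U \<in> sets \<mu>"
    and agree: "\<And>X. X \<in> sets \<mu> \<Longrightarrow> X \<subseteq> U \<Longrightarrow>
      emeasure \<mu>q ((\<lambda>h. \<Gamma> #>\<^bsub>GL\<^esub> h) ` X) = emeasure \<mu> X"
  shows "emeasure \<mu> (U \<inter> irregular A R) \<le> ennreal (2 * c\<^sub>0 / R)"
proof (cases "emeasure \<mu> (U \<inter> irregular A R) = 0")
  case False
  define E where "E = (\<lambda>h. \<Gamma> #>\<^bsub>GL\<^esub> h) ` (U \<inter> irregular A R)"
  define D where "D x = (discrepancy m (act_set act L x) A)\<^sup>2" for x
  have A': "A \<in> fmeasurable m" "(\<integral>\<^sup>+ x. D x \<partial>\<mu>q) \<le> ennreal (2 * c\<^sub>0 * measure m A)"
    using A by (auto simp: A1_def D_def)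
  have eq: "emeasure \<mu>q E = emeasure \<mu> (U \<inter> irregular A R)"
    unfolding E_def using A' U sets_irregular[of A R] by (intro agree) auto
  then have E: "E \<in> sets \<mu>q"
    using False emeasure_neq_0_sets by metis
  have D: "D x \<ge> ennreal (if measure m A = 0 then 1 else R * measure m A)" if x: "x \<in> E" for x
  proof -
    obtain h where h: "h \<in> irregular A R" "x = \<Gamma> #>\<^bsub>GL\<^esub> h"
      using x by (auto simp: E_def)
    then have hG: "h \<in> G"
      by (auto simp: irregular_def)
    show ?thesis
    proof (cases "finite (hits A h)")
      case True
      then have gt: "(real (card (hits A h)) - measure m A)\<^sup>2 > R * measure m A"
        using h(1) by (auto simp: irregular_def)
      have "D x = ennreal ((real (card (hits A h)) - measure m A)\<^sup>2)"
        using True by (simp add: D_def h(2) discrepancy_coset[OF hG] ennreal_power)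
      moreover have "(real (card (hits A h)) - measure m A)\<^sup>2 \<ge> 1" if "measure m A = 0"
      proof -
        have "card (hits A h) \<noteq> 0"
          using gt that by (metis diff_zero less_irrefl mult_zero_right of_nat_0 power_zero_numeral)
        then show ?thesis
          using that by simp
      qed
      ultimately show ?thesis
        using gt by (auto intro!: ennreal_leI)
    next
      case False
      then show ?thesis
        by (simp add: D_def h(2) discrepancy_coset[OF hG] ennreal_top_mult power2_eq_square)
    qed
  qed
  have "ennreal (if measure m A = 0 then 1 else R * measure m A) * emeasure \<mu>q E
      = (\<integral>\<^sup>+ x. ennreal (if measure m A = 0 then 1 else R * measure m A) * indicator E x \<partial>\<mu>q)"
    using E by (simp add: nn_integral_cmult_indicator)
  also have "\<dots> \<le> (\<integral>\<^sup>+ x. D x \<partial>\<mu>q)"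
  proof (rule nn_integral_mono)
    fix x
    show "ennreal (if measure m A = 0 then 1 else R * measure m A) * indicator E x \<le> D x"
    proof (cases "x \<in> E")
      case True
      show ?thesis
        unfolding indicator_simps(1)[OF True] mult_1_right by (rule D[OF True])
    next
      case False
      show ?thesis
        unfolding indicator_simps(2)[OF False] mult_zero_right by (rule zero_le)
    qed
  qed
  also have "\<dots> \<le> ennreal (2 * c\<^sub>0 * measure m A)"
    by (rule A')
  finally have le: "ennreal (if measure m A = 0 then 1 else R * measure m A) * emeasure \<mu>q E
    \<le> ennreal (2 * c\<^sub>0 * measure m A)" .
  show ?thesis
  proof (cases "measure m A = 0")
    case True
    \<comment> \<open>The bound reads \<open>1 * emeasure \<mu>q E \<le> 0\<close>, contradicting
      that the exceptional set is not null.\<close>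
    then show ?thesis
      using le eq False by simp
  next
    case False
    then have pos: "measure m A > 0"
      by (simp add: zero_less_measure_iff)
    interpret prob_space \<mu>q
      by (rule quotient_measure)
    have "R * measure m A * measure \<mu>q E \<le> 2 * c\<^sub>0 * measure m A"
      using le False c0 R pos
      by (simp add: emeasure_eq_measure ennreal_mult[symmetric])
    then have "measure \<mu>q E \<le> 2 * c\<^sub>0 / R"
      using pos R by (simp add: field_simps)
    then show ?thesis
      unfolding eq[symmetric] emeasure_eq_measure by (rule ennreal_leI)
  qed
qed simp

text \<open>For \<open>S\<close> take a maximal family of points of \<open>W\<close> with disjoint translates of \<open>X\<close>.\<close>
lemma finite_net:
  assumes X: "X \<in> fmeasurable \<mu>" "measure \<mu> X \<ge> \<kappa>" "\<kappa> > 0" "mat 1 \<in> X"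
    and W: "W \<subseteq> G"
    and Y: "Y \<in> fmeasurable \<mu>" "\<And>x w. x \<in> X \<Longrightarrow> w \<in> W \<Longrightarrow> x ** w \<in> Y"
  obtains S where "finite S" "S \<subseteq> W" "real (card S) * \<kappa> \<le> measure \<mu> Y"
    "\<And>g. g \<in> W \<Longrightarrow> \<exists>q\<in>S. \<exists>h\<^sub>1\<in>X. \<exists>h\<^sub>2\<in>X. h\<^sub>1 ** g = h\<^sub>2 ** q"
proof -
  define P where
    "P S \<longleftrightarrow> finite S \<and> S \<subseteq> W \<and> disjoint_family_on (\<lambda>q. X #>\<^bsub>GL\<^esub> q) S" for S
  have coset: "y \<in> X #>\<^bsub>GL\<^esub> q \<longleftrightarrow> (\<exists>x\<in>X. y = x ** q)" for y q
    by (auto simp: r_coset_def GL_def)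
  \<comment> \<open>Packing bound: the disjoint translates lie in \<open>Y\<close>, and by
    unimodularity each has the measure of \<open>X\<close>.\<close>
  have bound: "real (card S) * \<kappa> \<le> measure \<mu> Y" if "P S" for S
  proof -
    have S: "finite S" "S \<subseteq> G" "disjoint_family_on (\<lambda>q. X #>\<^bsub>GL\<^esub> q) S"
      using that W by (auto simp: P_def)
    have fm: "X #>\<^bsub>GL\<^esub> q \<in> fmeasurable \<mu>" "measure \<mu> (X #>\<^bsub>GL\<^esub> q) = measure \<mu> X"
      if "q \<in> S" for q
      using right_translate[of X q] X S that by auto
    then have fin: "emeasure \<mu> (X #>\<^bsub>GL\<^esub> q) \<noteq> \<infinity>" if "q \<in> S" for q
      using that by (auto simp: fmeasurable_def less_top)
    have "real (card S) * \<kappa> \<le> (\<Sum>q\<in>S. measure \<mu> (X #>\<^bsub>GL\<^esub> q))"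
      using X(2) by (simp add: fm mult_left_mono)
    also have "\<dots> = measure \<mu> (\<Union>q\<in>S. X #>\<^bsub>GL\<^esub> q)"
      using S fm fin by (intro measure_finite_Union[symmetric]) auto
    also have "\<dots> \<le> measure \<mu> Y"
    proof (rule measure_mono_fmeasurable)
      show "(\<Union>q\<in>S. X #>\<^bsub>GL\<^esub> q) \<subseteq> Y"
      proof
        fix y assume "y \<in> (\<Union>q\<in>S. X #>\<^bsub>GL\<^esub> q)"
        then obtain x q where "x \<in> X" "q \<in> S" "y = x ** q"
          unfolding coset UN_iff by blast
        then show "y \<in> Y"
          using Y(2) \<open>P S\<close> by (auto simp: P_def)
      qed
      show "(\<Union>q\<in>S. X #>\<^bsub>GL\<^esub> q) \<in> sets \<mu>"
        using S fm by (intro sets.finite_UN) auto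
    qed (rule Y)
    finally show ?thesis .
  qed
  have "P {}"
    by (simp add: P_def disjoint_family_on_def)
  moreover have "\<forall>S. P S \<longrightarrow> card S < Suc (nat \<lceil>measure \<mu> Y / \<kappa>\<rceil>)"
  proof (intro allI impI)
    fix S assume "P S"
    then have "real (card S) \<le> measure \<mu> Y / \<kappa>"
      using bound X(3) by (simp add: field_simps)
    then show "card S < Suc (nat \<lceil>measure \<mu> Y / \<kappa>\<rceil>)"
      by linarith
  qed
  ultimately obtain S where S: "P S" and max: "\<And>T. P T \<Longrightarrow> card T \<le> card S"
    using ex_has_greatest_nat[of P "{}" card "Suc (nat \<lceil>measure \<mu> Y / \<kappa>\<rceil>)"] by metis
  \<comment> \<open>If no translate from \<open>S\<close> meets that of \<open>g\<close>, then
    \<open>g\<close> can be added to the family, against maximality; \<open>mat 1 \<in> X\<close>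
    ensures that \<open>g\<close> is a new point.\<close>
  have "\<exists>q\<in>S. \<exists>h\<^sub>1\<in>X. \<exists>h\<^sub>2\<in>X. h\<^sub>1 ** g = h\<^sub>2 ** q" if g: "g \<in> W" for g
  proof (rule ccontr)
    assume no: "\<not> ?thesis"
    have "g \<notin> S"
      using no X(4) by blast
    moreover have "(X #>\<^bsub>GL\<^esub> g) \<inter> (\<Union>q\<in>S. X #>\<^bsub>GL\<^esub> q) = {}"
    proof (rule ccontr)
      assume "(X #>\<^bsub>GL\<^esub> g) \<inter> (\<Union>q\<in>S. X #>\<^bsub>GL\<^esub> q) \<noteq> {}"
      then obtain y q where "q \<in> S" "y \<in> X #>\<^bsub>GL\<^esub> g" "y \<in> X #>\<^bsub>GL\<^esub> q"
        by blast
      then show False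
        using no unfolding coset by blast
    qed
    ultimately have "P (insert g S)"
      using S g by (simp add: P_def disjoint_family_on_insert)
    then show False
      using max[of "insert g S"] S \<open>g \<notin> S\<close> by (simp add: P_def)
  qed
  then show ?thesis
    using S bound[OF S] by (intro that[of S]) (auto simp: P_def)
qed

end

section \<open>Shrinking targets\<close>

text \<open>The volume asymptotics keep the target index \<open>s\<close> and the radius
  \<open>t\<close> independent, since the sandwich evaluates them at different ends of a
  block.\<close>

locale shrinking_targets = orbit_counting V G act \<Gamma> L \<mu>q \<mu> m
  for V :: "(real^'d) set"
    and G :: "(real^'n^'n) set"
    and act :: "real^'d \<Rightarrow> real^'n^'n \<Rightarrow> real^'d"
    and \<Gamma> :: "(real^'n^'n) set"
    and L :: "(real^'d) set"
    and \<mu>q :: "(real^'n^'n) set measure"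
    and \<mu> :: "(real^'n^'n) measure"
    and m :: "(real^'d) measure" +
  fixes O_nbhd :: "real \<Rightarrow> (real^'n^'n) set"
    and B :: "real \<Rightarrow> (real^'d) set"
    and F :: "real^'d \<Rightarrow> real^'m"
    and \<Omega> :: "real \<Rightarrow> (real^'m) set"
    and c C :: "real^'n^'n \<Rightarrow> real"
    and c\<^sub>0 \<delta>\<^sub>0 d \<eta> a b \<delta> :: real
  assumes second_moment: "c\<^sub>0 > 0" "fmeasurable m \<subseteq> A1 act L \<mu>q m c\<^sub>0"
    and constants: "\<delta>\<^sub>0 > 0" "\<eta> > 0"
    and nbhds: "\<And>\<epsilon>. 0 < \<epsilon> \<Longrightarrow> \<epsilon> \<le> 1 \<Longrightarrow> identity_nbhd G (O_nbhd \<epsilon>)"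
    and nbhds_measure: "\<And>\<epsilon>. 0 < \<epsilon> \<Longrightarrow> \<epsilon> \<le> 1 \<Longrightarrow>
        O_nbhd \<epsilon> \<in> fmeasurable \<mu> \<and> measure \<mu> (O_nbhd \<epsilon>) \<ge> \<delta>\<^sub>0 * \<epsilon> powr d"
    and nbhds_mult: "\<And>\<epsilon>\<^sub>1 \<epsilon>\<^sub>2. 0 < \<epsilon>\<^sub>1 \<Longrightarrow> \<epsilon>\<^sub>1 \<le> 1 \<Longrightarrow> 0 < \<epsilon>\<^sub>2 \<Longrightarrow> \<epsilon>\<^sub>2 \<le> 1 \<Longrightarrow>
        \<eta> * (\<epsilon>\<^sub>1 + \<epsilon>\<^sub>2) \<le> 1 \<Longrightarrow>
        O_nbhd \<epsilon>\<^sub>1 <#>\<^bsub>GL\<^esub> O_nbhd \<epsilon>\<^sub>2 \<subseteq> O_nbhd (\<eta> * (\<epsilon>\<^sub>1 + \<epsilon>\<^sub>2))"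
    and B_subset: "\<And>t. t \<ge> 1 \<Longrightarrow> B t \<subseteq> V"
    and B_increasing: "\<And>s t. 1 \<le> s \<Longrightarrow> s \<le> t \<Longrightarrow> B s \<subseteq> B t"
    and B_inner: "\<And>t \<epsilon>. t \<ge> 1 \<Longrightarrow> 0 < \<epsilon> \<Longrightarrow> \<epsilon> \<le> 1 \<Longrightarrow> t * (1 - \<epsilon>) \<ge> 1 \<Longrightarrow>
        B (t * (1 - \<epsilon>)) \<subseteq> (\<Inter>h\<in>O_nbhd \<epsilon>. act_set act (B t) {h})"
    and B_outer: "\<And>t \<epsilon>. t \<ge> 1 \<Longrightarrow> 0 < \<epsilon> \<Longrightarrow> \<epsilon> \<le> 1 \<Longrightarrow>
        (\<Union>h\<in>O_nbhd \<epsilon>. act_set act (B t) {h}) \<subseteq> B (t * (1 + \<epsilon>))"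
    and volume_asymptotics: "\<And>s g t. s > 1 \<Longrightarrow> g \<in> G \<Longrightarrow> t \<ge> 1 \<Longrightarrow>
        F_preimage V act F g (\<Omega> s) \<inter> B t \<in> fmeasurable m \<and>
        (\<exists>\<theta>. \<bar>\<theta>\<bar> \<le> C g * t powr (- \<delta>) \<and>
             measure m (F_preimage V act F g (\<Omega> s) \<inter> B t)
               = c g * s powr (- b) * t powr a * (1 + \<theta>))"
    and \<Omega>_decreasing: "\<And>s t. 1 < s \<Longrightarrow> s \<le> t \<Longrightarrow> \<Omega> t \<subseteq> \<Omega> s"
    and b_range: "0 < b" "b < a"
begin

text \<open>In the coordinate w = vq this is the preimage of \<open>X\<close> under \<open>F\<close>
  intersected with the translate B_s q. Only the second set depends on \<open>q\<close>, so
  comparing targets reduces to comparing translates of \<open>B\<close>.\<close>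

definition target :: "(real^'m) set \<Rightarrow> real \<Rightarrow> real^'n^'n \<Rightarrow> (real^'d) set" where
  "target X s q = act_set act (F_preimage V act F q X \<inter> B s) {q}"

lemma target_iff:
  "s \<ge> 1 \<Longrightarrow> w \<in> target X s q \<longleftrightarrow> F w \<in> X \<and> w \<in> act_set act (B s) {q}"
  using B_subset[of s] by (auto simp: target_def act_set_def F_preimage_def)

lemma target_mono:
  assumes "X \<subseteq> X'" "act_set act (B s) {g} \<subseteq> act_set act (B s') {q}" "s \<ge> 1" "s' \<ge> 1"
  shows "target X s g \<subseteq> target X' s' q"
  using assms by (auto simp: target_iff)

lemma target_fmeasurable:
  assumes "s > 1" "q \<in> G" "t \<ge> 1"
  shows "target (\<Omega> s) t q \<in> fmeasurable m"
  using volume_asymptotics[OF assms] fmeasurable_act_set assms by (auto simp: target_def)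

lemma measure_target:
  assumes "s > 1" "q \<in> G" "t \<ge> 1"
  obtains \<theta> where "\<bar>\<theta>\<bar> \<le> C q * t powr (- \<delta>)"
    "measure m (target (\<Omega> s) t q) = c q * s powr (- b) * t powr a * (1 + \<theta>)"
  using volume_asymptotics[OF assms] fmeasurable_act_set(2) assms by (auto simp: target_def)

lemma hits_target:
  assumes "g \<in> G" "t \<ge> 1"
  shows "hits (target X t g) g = {v \<in> L. F (act v g) \<in> X \<and> v \<in> B t}"
proof -
  have "act v g \<in> act_set act (B t) {g} \<longleftrightarrow> v \<in> B t" if "v \<in> L" for v
    using inj_onD[OF inj_on_act[OF assms(1)], of v] that points(1) B_subset[OF assms(2)]
    by (auto simp: act_set_def subset_iff)
  then show ?thesis
    using assms(2) by (auto simp: hits_def target_iff)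
qed

lemma nbhd_subset: "0 < \<epsilon> \<Longrightarrow> \<epsilon> \<le> 1 \<Longrightarrow> O_nbhd \<epsilon> \<subseteq> G"
  using nbhds by (auto simp: identity_nbhd_def)

lemma one_in_nbhd: "0 < \<epsilon> \<Longrightarrow> \<epsilon> \<le> 1 \<Longrightarrow> mat 1 \<in> O_nbhd \<epsilon>"
  using nbhds[of \<epsilon>] by (auto simp: identity_nbhd_def GL_def)

text \<open>
  Two points \<open>g\<close> and \<open>q\<close> with intersecting neighbourhoods \<open>\<O>\<^sub>\<epsilon>g\<close> and \<open>\<O>\<^sub>\<epsilon>q\<close> give comparable
  translates of the sets \<open>B\<^sub>t\<close>, even though \<open>g\<close> need not lie in \<open>\<O>\<^sub>\<epsilon>q\<close>.
\<close>
lemma translate_B_subset: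
  assumes \<epsilon>: "0 < \<epsilon>" "\<epsilon> < 1" and h: "h\<^sub>1 \<in> O_nbhd \<epsilon>" "h\<^sub>2 \<in> O_nbhd \<epsilon>"
    and gq: "g \<in> G" "q \<in> G" "h\<^sub>1 ** g = h\<^sub>2 ** q" and t: "t \<ge> 1"
  shows "act_set act (B t) {g} \<subseteq> act_set act (B (t * ((1 + \<epsilon>) / (1 - \<epsilon>)))) {q}"
proof
  fix w assume "w \<in> act_set act (B t) {g}"
  then obtain v where v: "v \<in> B t" "w = act v g"
    by (auto simp: act_set_def)
  \<comment> \<open>With v = u h_1 for some u in B_s, the point w = vg equals (u h_2)q. The inner
    inclusion costs the factor 1/(1-\<epsilon>), the outer one 1+\<epsilon>.\<close>
  define s where "s = t / (1 - \<epsilon>)"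
  have s: "s \<ge> 1" "s * (1 - \<epsilon>) = t"
    using \<epsilon> t by (auto simp: s_def field_simps)
  have hG: "h\<^sub>1 \<in> G" "h\<^sub>2 \<in> G"
    using h nbhd_subset[of \<epsilon>] \<epsilon> by auto
  have "v \<in> act_set act (B s) {h\<^sub>1}"
    using B_inner[of s \<epsilon>] s \<epsilon> t v h(1) by auto
  then obtain u where u: "u \<in> B s" "v = act u h\<^sub>1"
    by (auto simp: act_set_def)
  then have uV: "u \<in> V"
    using B_subset s by blast
  have "w = act (act u h\<^sub>2) q"
    using act_mult[OF uV hG(1) gq(1)] act_mult[OF uV hG(2) gq(2)] gq(3) u v by simp
  moreover have "act u h\<^sub>2 \<in> B (s * (1 + \<epsilon>))"
    using B_outer[of s \<epsilon>] s \<epsilon> u h(2) by (auto simp: act_set_def)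
  moreover have "s * (1 + \<epsilon>) = t * ((1 + \<epsilon>) / (1 - \<epsilon>))"
    by (simp add: s_def)
  ultimately show "w \<in> act_set act (B (t * ((1 + \<epsilon>) / (1 - \<epsilon>)))) {q}"
    by (auto simp: act_set_def)
qed

text \<open>Intersection of the two translated neighbourhoods: a relation symmetric in
  \<open>g\<close> and \<open>q\<close>, and exactly what maximality of a disjoint family
  provides.\<close>

definition close :: "real \<Rightarrow> real^'n^'n \<Rightarrow> real^'n^'n \<Rightarrow> bool" where
  "close \<epsilon> g q \<longleftrightarrow> (\<exists>h\<^sub>1\<in>O_nbhd \<epsilon>. \<exists>h\<^sub>2\<in>O_nbhd \<epsilon>. h\<^sub>1 ** g = h\<^sub>2 ** q)"

lemma act_set_subset: "act_set act (B s) {q} \<subseteq> act_set act (B s') {q}" if "1 \<le> s" "s \<le> s'"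
  using B_increasing[OF that] by (auto simp: act_set_def)

lemma close_subset:
  assumes "close (1 / real k) g q" "k \<ge> 2" "g \<in> G" "q \<in> G" "t \<ge> 1"
  defines "\<rho> \<equiv> (real k + 1) / (real k - 1)"
  shows "act_set act (B t) {g} \<subseteq> act_set act (B (t * \<rho>)) {q}"
    "act_set act (B t) {q} \<subseteq> act_set act (B (t * \<rho>)) {g}"
proof -
  have \<rho>: "(1 + 1 / real k) / (1 - 1 / real k) = \<rho>"
    using assms(2) by (simp add: \<rho>_def field_simps)
  obtain h\<^sub>1 h\<^sub>2 where h: "h\<^sub>1 \<in> O_nbhd (1 / real k)" "h\<^sub>2 \<in> O_nbhd (1 / real k)"
      "h\<^sub>1 ** g = h\<^sub>2 ** q"
    using assms(1) by (auto simp: close_def)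
  have k: "0 < 1 / real k" "1 / real k < 1"
    using assms(2) by auto
  show "act_set act (B t) {g} \<subseteq> act_set act (B (t * \<rho>)) {q}"
    using translate_B_subset[OF k h(1,2) assms(3,4) h(3) assms(5)] \<rho> by simp
  show "act_set act (B t) {q} \<subseteq> act_set act (B (t * \<rho>)) {g}"
    using translate_B_subset[OF k h(2,1) assms(4,3) h(3)[symmetric] assms(5)] \<rho> by simp
qed

section \<open>Discretised targets and the sandwich at a regular point\<close>

text \<open>The targets decrease, so over a block the largest one has the left index, while the
  largest radius sits at the right end. One further factor (k+1)/(k-1) pays for passing between
  \<open>g\<close> and \<open>q\<close>; \<open>inner_target\<close> reverses every choice.\<close>

definition outer_target :: "real \<Rightarrow> nat \<Rightarrow> real^'n^'n \<Rightarrow> (real^'d) set" where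
  "outer_target \<beta> k q = target (\<Omega> (real k powr \<beta>))
     ((real k + 1) powr \<beta> * ((real k + 1) / (real k - 1))) q"

definition inner_target :: "real \<Rightarrow> nat \<Rightarrow> real^'n^'n \<Rightarrow> (real^'d) set" where
  "inner_target \<beta> k q = target (\<Omega> ((real k + 1) powr \<beta>))
     (real k powr \<beta> / ((real k + 1) / (real k - 1))) q"

text \<open>The tested sets depend on \<open>q\<close> and \<open>k\<close> but not on
  \<open>g\<close> or \<open>t\<close>, so a finite net of points \<open>q\<close> leaves finitely
  many exceptional sets for each \<open>k\<close>.\<close>

definition regular_at :: "real \<Rightarrow> nat \<Rightarrow> real^'n^'n \<Rightarrow> bool" where
  "regular_at \<beta> k g \<longleftrightarrow> (\<exists>q\<in>G. close (1 / real k) g q \<and>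
     g \<notin> irregular (outer_target \<beta> k q) (real k powr (\<beta> * (a - b) - 2)) \<and>
     g \<notin> irregular (inner_target \<beta> k q) (real k powr (\<beta> * (a - b) - 2)))"

lemma not_irregular:
  assumes "h \<in> G" "h \<notin> irregular A R"
  shows "finite (hits A h)"
    "\<bar>real (card (hits A h)) - measure m A\<bar> \<le> sqrt (R * measure m A)"
  using assms real_le_rsqrt[of "\<bar>real (card (hits A h)) - measure m A\<bar>"]
  by (auto simp: irregular_def)

text \<open>The inner set for \<open>g\<close>, the inner target for \<open>q\<close>, the actual
  target, the outer target for \<open>q\<close> and the outer set for \<open>g\<close> form an
  increasing chain. Counts are controlled at \<open>q\<close>, measures at \<open>g\<close>; passing
  from \<open>g\<close> to \<open>q\<close> and back accounts for the square of
  \<open>\<rho>\<close>.\<close>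

lemma count_of_regular_at:
  assumes g: "g \<in> G" and \<beta>: "\<beta> > 0" and reg: "regular_at \<beta> k g" and k: "k \<ge> 2"
    and large: "real k powr \<beta> / ((real k + 1) / (real k - 1))\<^sup>2 \<ge> 1"
    and t: "real k powr \<beta> \<le> t" "t \<le> (real k + 1) powr \<beta>"
  defines "\<rho> \<equiv> (real k + 1) / (real k - 1)"
  defines "mp \<equiv> measure m (target (\<Omega> (real k powr \<beta>)) ((real k + 1) powr \<beta> * \<rho>\<^sup>2) g)"
    and "mm \<equiv> measure m (target (\<Omega> ((real k + 1) powr \<beta>)) (real k powr \<beta> / \<rho>\<^sup>2) g)"
    and "Z \<equiv> {v \<in> L. F (act v g) \<in> \<Omega> t \<and> v \<in> B t}"
  shows "finite Z"
    "real (card Z) \<le> mp + sqrt (real k powr (\<beta> * (a - b) - 2) * mp)"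
    "real (card Z) \<ge> mm - sqrt (real k powr (\<beta> * (a - b) - 2) * mp)"
proof -
  define T T' where "T = real k powr \<beta>" and "T' = (real k + 1) powr \<beta>"
  define R where "R = real k powr (\<beta> * (a - b) - 2)"
  have \<rho>: "\<rho> > 1"
    using k by (simp add: \<rho>_def field_simps)
  have sz: "T > 1" "T \<le> t" "t \<le> T'" "T / \<rho>\<^sup>2 \<ge> 1" "R \<ge> 0"
    using k \<beta> t large by (auto simp: T_def T'_def R_def \<rho>_def intro!: gr_one_powr)
  have T: "1 \<le> t" "1 < T'" "1 \<le> T / \<rho>" "1 \<le> T' * \<rho>" "1 \<le> T' * \<rho>\<^sup>2" "T / \<rho> \<le> T"
    "T / \<rho> \<le> T' * \<rho>" "t * \<rho> \<le> T' * \<rho>"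
  proof -
    show "1 \<le> t" "1 < T'"
      using sz by auto
    have "T / \<rho>\<^sup>2 \<le> T / \<rho>"
      using sz \<rho> by (intro divide_left_mono) (auto simp: power2_eq_square)
    then show "1 \<le> T / \<rho>"
      using sz by linarith
    have 1: "T' \<le> T' * \<rho>" "T' * \<rho> \<le> T' * \<rho>\<^sup>2"
      using sz \<rho> by (auto simp: power2_eq_square)
    then show "1 \<le> T' * \<rho>" "1 \<le> T' * \<rho>\<^sup>2"
      using sz by linarith+
    show 2: "T / \<rho> \<le> T"
      using sz \<rho> by (simp add: divide_le_eq)
    then show "T / \<rho> \<le> T' * \<rho>"
      using 1 sz by linarith
    show "t * \<rho> \<le> T' * \<rho>"
      using sz \<rho> by simp
  qed
  obtain q where q: "q \<in> G" "close (1 / real k) g q"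
    "g \<notin> irregular (outer_target \<beta> k q) R" "g \<notin> irregular (inner_target \<beta> k q) R"
    using reg by (auto simp: regular_at_def R_def)
  define Ao Ai where "Ao = outer_target \<beta> k q" and "Ai = inner_target \<beta> k q"
  have Ao: "Ao = target (\<Omega> T) (T' * \<rho>) q" and Ai: "Ai = target (\<Omega> T') (T / \<rho>) q"
    by (auto simp: Ao_def Ai_def outer_target_def inner_target_def T_def T'_def \<rho>_def)
  note sub = close_subset[OF q(2) k g q(1), folded \<rho>_def]
  have 1: "target (\<Omega> t) t g \<subseteq> Ao"
    unfolding Ao using sub(1)[of t] act_set_subset[of "t * \<rho>" "T' * \<rho>" q] \<Omega>_decreasing[of T t] T sz \<rho>
      mult_mono[of 1 t 1 \<rho>]
    by (intro target_mono) auto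
  have 2: "Ai \<subseteq> target (\<Omega> t) t g"
    unfolding Ai using sub(2)[of "T / \<rho>"] act_set_subset[of T t g] \<Omega>_decreasing[of t T'] T sz \<rho>
    by (intro target_mono) auto
  have fm: "Ao \<in> fmeasurable m" "Ai \<in> fmeasurable m"
    "target (\<Omega> T) (T' * \<rho>\<^sup>2) g \<in> fmeasurable m"
    using T sz q(1) g by (auto simp: Ao Ai intro!: target_fmeasurable)
  have "Ao \<subseteq> target (\<Omega> T) (T' * \<rho>\<^sup>2) g"
    unfolding Ao using sub(2)[of "T' * \<rho>"] T by (intro target_mono) (auto simp: power2_eq_square mult.assoc)
  then have mo: "measure m Ao \<le> mp"
    using fm by (auto simp: mp_def T_def T'_def intro!: measure_mono_fmeasurable)
  have "target (\<Omega> T') (T / \<rho>\<^sup>2) g \<subseteq> Ai"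
    unfolding Ai using sub(1)[of "T / \<rho>\<^sup>2"] T sz \<rho>
    by (intro target_mono) (auto simp: power2_eq_square)
  then have mi: "mm \<le> measure m Ai"
    using fm target_fmeasurable[of T' g "T / \<rho>\<^sup>2"] g T sz
    by (auto simp: mm_def T_def T'_def intro!: measure_mono_fmeasurable)
  have "measure m Ai \<le> measure m Ao"
    using fm 1 2 by (intro measure_mono_fmeasurable) auto
  then have sq: "sqrt (R * measure m Ao) \<le> sqrt (R * mp)" "sqrt (R * measure m Ai) \<le> sqrt (R * mp)"
    using mo sz by (auto intro!: mult_left_mono)
  have Z: "Z = hits (target (\<Omega> t) t g) g"
    unfolding Z_def using hits_target[OF g] T by simp
  have Zs: "hits Ai g \<subseteq> Z" "Z \<subseteq> hits Ao g"
    unfolding Z using 1 2 by (auto simp: hits_def)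
  note o = not_irregular[OF g q(3), folded Ao_def] and i = not_irregular[OF g q(4), folded Ai_def]
  show "finite Z"
    using Zs(2) o(1) finite_subset by blast
  then have "card (hits Ai g) \<le> card Z" "card Z \<le> card (hits Ao g)"
    using Zs o(1) by (auto intro: card_mono)
  then show "real (card Z) \<le> mp + sqrt (real k powr (\<beta> * (a - b) - 2) * mp)"
    "real (card Z) \<ge> mm - sqrt (real k powr (\<beta> * (a - b) - 2) * mp)"
    using o(2) i(2) mo mi sq unfolding R_def[symmetric] by linarith+
qed

lemma targets_fmeasurable:
  assumes "q \<in> G" "\<beta> > 0" "k \<ge> 2" "real k powr \<beta> / ((real k + 1) / (real k - 1)) \<ge> 1"
  shows "outer_target \<beta> k q \<in> fmeasurable m" "inner_target \<beta> k q \<in> fmeasurable m"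
proof -
  have k: "real k powr \<beta> > 1" "(real k + 1) powr \<beta> > 1"
    using assms by (auto intro!: gr_one_powr)
  moreover have "(real k + 1) / (real k - 1) \<ge> 1"
    using assms by simp
  ultimately have "(real k + 1) powr \<beta> * ((real k + 1) / (real k - 1)) \<ge> 1"
    using mult_mono[of 1 "(real k + 1) powr \<beta>" 1 "(real k + 1) / (real k - 1)"] by simp
  then show "outer_target \<beta> k q \<in> fmeasurable m" "inner_target \<beta> k q \<in> fmeasurable m"
    using k assms by (auto simp: outer_target_def inner_target_def intro!: target_fmeasurable)
qed

text \<open>
  The sets \<open>\<O>\<^sub>\<epsilon>\<close> are not assumed to increase with \<open>\<epsilon>\<close>; multiplying by the identity in a second
  neighbourhood still places \<open>\<O>\<^bsub>\<epsilon>\<^sub>2\<^esub>\<close> inside \<open>\<O>\<^sub>s\<close> for \<open>s\<close> between \<open>\<eta>\<epsilon>\<^sub>2\<close> and \<open>\<eta>(\<epsilon>\<^sub>2 + 1)\<close>.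
\<close>
lemma nbhd_product_bounded:
  obtains \<epsilon>\<^sub>1 \<epsilon>\<^sub>2 \<tau> where "0 < \<epsilon>\<^sub>1" "0 < \<epsilon>\<^sub>2" "\<epsilon>\<^sub>2 \<le> 1" "0 < \<tau>" "\<tau> \<le> 1"
    "\<And>\<epsilon> x y. 0 < \<epsilon> \<Longrightarrow> \<epsilon> \<le> \<epsilon>\<^sub>1 \<Longrightarrow> x \<in> O_nbhd \<epsilon> \<Longrightarrow> y \<in> O_nbhd \<epsilon>\<^sub>2 \<Longrightarrow> x ** y \<in> O_nbhd \<tau>"
proof -
  have mult: "x ** y \<in> O_nbhd (\<eta> * (\<epsilon> + \<epsilon>'))" if "0 < \<epsilon>" "\<epsilon> \<le> 1" "0 < \<epsilon>'" "\<epsilon>' \<le> 1"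
    "\<eta> * (\<epsilon> + \<epsilon>') \<le> 1" "x \<in> O_nbhd \<epsilon>" "y \<in> O_nbhd \<epsilon>'" for x y \<epsilon> \<epsilon>'
    using nbhds_mult[OF that(1-5)] that(6,7) by (auto simp: set_mult_def GL_def)
  \<comment> \<open>\<open>\<eta> * \<sigma>\<close> has to be an admissible parameter, and
    \<open>\<sigma> \<le> \<eta>\<close> will keep the auxiliary \<open>r\<close> at most 1.\<close>
  define \<sigma> where "\<sigma> = min (min 1 (1 / \<eta>)) \<eta>"
  define \<epsilon>\<^sub>2 where "\<epsilon>\<^sub>2 = min 1 (\<sigma> / (4 * \<eta>))"
  have "0 < \<sigma>" "\<sigma> \<le> 1" "\<sigma> \<le> \<eta>" "\<sigma> \<le> 1 / \<eta>"
    using constants(2) by (auto simp: \<sigma>_def)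
  then have \<sigma>: "0 < \<sigma>" "\<sigma> \<le> 1" "\<sigma> \<le> \<eta>" "\<eta> * \<sigma> \<le> 1"
    using constants(2) by (auto simp: field_simps)
  have "\<epsilon>\<^sub>2 \<le> \<sigma> / (4 * \<eta>)"
    by (simp add: \<epsilon>\<^sub>2_def)
  then have \<epsilon>2: "0 < \<epsilon>\<^sub>2" "\<epsilon>\<^sub>2 \<le> 1" "\<eta> * \<epsilon>\<^sub>2 \<le> \<sigma> / 4"
    using \<sigma> constants(2) by (auto simp: \<epsilon>\<^sub>2_def field_simps)
  have "x ** y \<in> O_nbhd (\<eta> * \<sigma>)"
    if \<epsilon>: "0 < \<epsilon>" "\<epsilon> \<le> \<sigma> / 2" and xy: "x \<in> O_nbhd \<epsilon>" "y \<in> O_nbhd \<epsilon>\<^sub>2" for x y \<epsilon>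
  proof -
    \<comment> \<open>Multiplying \<open>y\<close> by the identity of \<open>O_nbhd r\<close> places
      it in the neighbourhood of parameter \<open>\<sigma> - \<epsilon>\<close>. The product with
      \<open>x\<close> then has parameter \<open>\<eta> * \<sigma>\<close>, independent of
      \<open>\<epsilon>\<close>.\<close>
    define r where "r = (\<sigma> - \<epsilon>) / \<eta> - \<epsilon>\<^sub>2"
    have r: "0 < r" "r \<le> 1" "\<eta> * (\<epsilon>\<^sub>2 + r) = \<sigma> - \<epsilon>"
    proof -
      have "\<eta> * r = \<sigma> - \<epsilon> - \<eta> * \<epsilon>\<^sub>2"
        using constants(2) by (simp add: r_def field_simps)
      moreover have "\<eta> * \<epsilon>\<^sub>2 > 0"
        using constants(2) \<epsilon>2(1) by simp
      moreover have "\<eta> * (\<epsilon>\<^sub>2 + r) = \<eta> * \<epsilon>\<^sub>2 + \<eta> * r"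
        by (rule distrib_left)
      ultimately have "\<eta> * r > 0" "\<eta> * r \<le> \<eta> * 1" "\<eta> * (\<epsilon>\<^sub>2 + r) = \<sigma> - \<epsilon>"
        using \<sigma> \<epsilon>2(3) \<epsilon> by linarith+
      then show "0 < r" "r \<le> 1" "\<eta> * (\<epsilon>\<^sub>2 + r) = \<sigma> - \<epsilon>"
        using constants(2) by (auto simp: zero_less_mult_iff)
    qed
    have "y ** mat 1 \<in> O_nbhd (\<eta> * (\<epsilon>\<^sub>2 + r))"
      using r \<epsilon>2 \<sigma> \<epsilon> xy one_in_nbhd[of r] by (intro mult) auto
    then have "y \<in> O_nbhd (\<sigma> - \<epsilon>)"
      by (simp add: r(3))
    then have "x ** y \<in> O_nbhd (\<eta> * (\<epsilon> + (\<sigma> - \<epsilon>)))"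
      using \<sigma> \<epsilon> xy by (intro mult) auto
    then show ?thesis
      by simp
  qed
  then show ?thesis
    using \<sigma> \<epsilon>2 constants(2) by (intro that[of "\<sigma> / 2" \<epsilon>\<^sub>2 "\<eta> * \<sigma>"]) auto
qed

section \<open>Almost every point is eventually regular\<close>

text \<open>Working near \<open>p\<close> serves two purposes: the Haar measure agrees there with
  \<open>\<mu>q\<close>, which carries the second moment bound, and all translates used for the net
  lie in one set of finite measure.\<close>

lemma regular_at_locally:
  assumes p: "p \<in> G" and \<beta>: "\<beta> > 0" "\<beta> * (a - b) > d + 3"
  obtains W where "openin (top_of_set G) W" "p \<in> W"
    "AE g in \<mu>. g \<in> W \<longrightarrow> (\<forall>\<^sub>F k in sequentially. regular_at \<beta> k g)"
proof -
  obtain U where U: "openin (top_of_set G) U" "p \<in> U"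
    and agree: "\<And>X. X \<in> sets \<mu> \<Longrightarrow> X \<subseteq> U \<Longrightarrow>
      emeasure \<mu>q ((\<lambda>h. \<Gamma> #>\<^bsub>GL\<^esub> h) ` X) = emeasure \<mu> X"
    using haar(2) p unfolding locally_agrees_def by metis
  obtain \<epsilon>\<^sub>1 \<epsilon>\<^sub>2 \<tau> where \<epsilon>: "0 < \<epsilon>\<^sub>1" "0 < \<epsilon>\<^sub>2" "\<epsilon>\<^sub>2 \<le> 1" "0 < \<tau>" "\<tau> \<le> 1"
    and prod: "\<And>\<epsilon> x y. 0 < \<epsilon> \<Longrightarrow> \<epsilon> \<le> \<epsilon>\<^sub>1 \<Longrightarrow> x \<in> O_nbhd \<epsilon> \<Longrightarrow> y \<in> O_nbhd \<epsilon>\<^sub>2 \<Longrightarrow>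
      x ** y \<in> O_nbhd \<tau>"
    using nbhd_product_bounded by metis
  obtain p' where p': "p' \<in> G" "p ** p' = mat 1" "p' ** p = mat 1"
    using inverse_ex[OF p] by metis
  obtain N where N: "openin (top_of_set G) N" "mat 1 \<in> N" "N \<subseteq> O_nbhd \<epsilon>\<^sub>2"
    using nbhds[OF \<epsilon>(2,3)] by (auto simp: identity_nbhd_def GL_def)
  \<comment> \<open>For w in \<open>W\<close> the element w p^(-1) lies in
    \<open>O_nbhd \<epsilon>\<^sub>2\<close>. Hence xw = (x w p^(-1))p lies in the translate
    \<open>Y\<close> of \<open>O_nbhd \<tau>\<close>, whose measure does not depend on
    \<open>k\<close>.\<close>
  define W where "W = U \<inter> (G \<inter> (\<lambda>g. g ** p') -` N)"
  have W: "openin (top_of_set G) W" "p \<in> W" "W \<subseteq> G"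
  proof -
    have "openin (top_of_set G) (G \<inter> (\<lambda>g. g ** p') -` N)"
      using mult_closed p'(1)
      by (intro continuous_openin_preimage[OF continuous_on_matrix_mult_right _ N(1)]) auto
    then show "openin (top_of_set G) W"
      using U(1) by (simp add: W_def openin_Int)
    show "p \<in> W" "W \<subseteq> G"
      using U p p' N(2) by (auto simp: W_def)
  qed
  have sets_open: "X \<in> sets \<mu>" if X: "openin (top_of_set G) X" for X
  proof -
    obtain T where "open T" "X = G \<inter> T"
      using X by (auto simp: openin_open)
    then show ?thesis
      unfolding sets_\<mu> by (auto simp: sets_restrict_space)
  qed
  define Y where "Y = O_nbhd \<tau> #>\<^bsub>GL\<^esub> p"
  have Y: "Y \<in> fmeasurable \<mu>"
  proof -
    have "\<delta>\<^sub>0 * \<tau> powr d > 0"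
      using constants(1) \<epsilon> by simp
    then have "measure \<mu> (O_nbhd \<tau>) > 0"
      using nbhds_measure[OF \<epsilon>(4,5)] by linarith
    then show ?thesis
      unfolding Y_def using nbhds_measure[OF \<epsilon>(4,5)] p by (intro right_translate) auto
  qed
  define R where "R k = real k powr (\<beta> * (a - b) - 2)" for k
  define adm where "adm k \<longleftrightarrow> k \<ge> 2 \<and> 1 / real k \<le> \<epsilon>\<^sub>1 \<and>
    real k powr \<beta> / ((real k + 1) / (real k - 1)) \<ge> 1" for k
  have adm: "\<forall>\<^sub>F k in sequentially. adm k"
  proof -
    have "\<forall>\<^sub>F k in sequentially. 1 / real k \<le> \<epsilon>\<^sub>1"
      using \<epsilon>(1) by real_asymp
    moreover have "\<forall>\<^sub>F k in sequentially. real k powr \<beta> / ((real k + 1) / (real k - 1)) \<ge> 1"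
      using \<beta>(1) by real_asymp
    ultimately show ?thesis
      using eventually_ge_at_top[of "2::nat"] unfolding adm_def by eventually_elim auto
  qed
  have "\<exists>S. finite S \<and> S \<subseteq> W \<and> real (card S) * (\<delta>\<^sub>0 * (1 / real k) powr d) \<le> measure \<mu> Y \<and>
      (\<forall>g\<in>W. \<exists>q\<in>S. close (1 / real k) g q)" if k: "adm k" for k
  proof -
    have k': "0 < 1 / real k" "1 / real k \<le> 1" "1 / real k \<le> \<epsilon>\<^sub>1"
      using k by (auto simp: adm_def)
    have XW: "x ** w \<in> Y" if "x \<in> O_nbhd (1 / real k)" "w \<in> W" for x w
    proof -
      have "w ** p' \<in> O_nbhd \<epsilon>\<^sub>2"
        using that N(3) by (auto simp: W_def)
      then have "x ** (w ** p') \<in> O_nbhd \<tau>"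
        using prod k' that by blast
      moreover have "x ** (w ** p') ** p = x ** w"
        using p'(3) by (simp flip: matrix_mul_assoc)
      ultimately show ?thesis
        unfolding Y_def by (force simp: r_coset_def GL_def)
    qed
    have pos: "\<delta>\<^sub>0 * (1 / real k) powr d > 0"
      using constants(1) k' by simp
    have X: "O_nbhd (1 / real k) \<in> fmeasurable \<mu>"
      "measure \<mu> (O_nbhd (1 / real k)) \<ge> \<delta>\<^sub>0 * (1 / real k) powr d"
      using nbhds_measure[OF k'(1,2)] by auto
    show ?thesis
    proof (rule finite_net[OF X pos one_in_nbhd[OF k'(1,2)] W(3) Y XW])
      fix S
      assume S: "finite S" "S \<subseteq> W" "real (card S) * (\<delta>\<^sub>0 * (1 / real k) powr d) \<le> measure \<mu> Y"
        and net: "\<And>g. g \<in> W \<Longrightarrow> \<exists>q\<in>S. \<exists>h\<^sub>1\<in>O_nbhd (1 / real k). \<exists>h\<^sub>2\<in>O_nbhd (1 / real k).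
          h\<^sub>1 ** g = h\<^sub>2 ** q"
      have "\<forall>g\<in>W. \<exists>q\<in>S. close (1 / real k) g q"
        using net unfolding close_def by (intro ballI)
      with S show ?thesis
        by (intro exI[of _ S] conjI)
    qed
  qed
  then obtain S where S: "\<And>k. adm k \<Longrightarrow> finite (S k)" "\<And>k. adm k \<Longrightarrow> S k \<subseteq> W"
    "\<And>k. adm k \<Longrightarrow> real (card (S k)) * (\<delta>\<^sub>0 * (1 / real k) powr d) \<le> measure \<mu> Y"
    "\<And>k g. adm k \<Longrightarrow> g \<in> W \<Longrightarrow> \<exists>q\<in>S k. close (1 / real k) g q"
    by metis
  \<comment> \<open>Empty for the finitely many inadmissible \<open>k\<close>, so that the bounds
    below hold for every \<open>k\<close>.\<close>
  define E where "E k = (if adm k then (\<Union>q\<in>S k. W \<inter> irregular (outer_target \<beta> k q) (R k) \<union>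
    W \<inter> irregular (inner_target \<beta> k q) (R k)) else {})" for k
  \<comment> \<open>The net has at most (measure of \<open>Y\<close>)/\<delta>_0 times k^d points,
    each contributing two exceptional sets of measure at most
    \<open>2 * c\<^sub>0 / R k\<close>.\<close>
  define K where "K = measure \<mu> Y / \<delta>\<^sub>0 * (4 * c\<^sub>0)"
  have K: "K \<ge> 0"
    using constants(1) second_moment(1) by (simp add: K_def)
  have irr: "W \<inter> irregular A (R k) \<in> sets \<mu>"
    "emeasure \<mu> (W \<inter> irregular A (R k)) \<le> ennreal (2 * c\<^sub>0 / R k)"
    if "A \<in> fmeasurable m" "adm k" for A k
  proof -
    show "W \<inter> irregular A (R k) \<in> sets \<mu>"
      using sets_open[OF W(1)] sets_irregular[of A "R k"] that by auto
    have "R k > 0"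
      using that(2) by (simp add: R_def adm_def)
    moreover have "X \<in> sets \<mu> \<Longrightarrow> X \<subseteq> W \<Longrightarrow>
        emeasure \<mu>q ((\<lambda>h. \<Gamma> #>\<^bsub>GL\<^esub> h) ` X) = emeasure \<mu> X" for X
      by (rule agree) (auto simp: W_def)
    ultimately show "emeasure \<mu> (W \<inter> irregular A (R k)) \<le> ennreal (2 * c\<^sub>0 / R k)"
      using second_moment that sets_open[OF W(1)] by (intro emeasure_irregular) auto
  qed
  have fmt: "outer_target \<beta> k q \<in> fmeasurable m" "inner_target \<beta> k q \<in> fmeasurable m"
    if "adm k" "q \<in> S k" for k q
    using targets_fmeasurable[of q \<beta> k] S(2)[OF that(1)] W(3) that \<beta>(1) by (auto simp: adm_def)
  have E: "E k \<in> sets \<mu>" "emeasure \<mu> (E k) \<le> ennreal (K * real k powr (d + 2 - \<beta> * (a - b)))" for k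
  proof -
    show "E k \<in> sets \<mu>"
      using S(1)[of k] irr(1) fmt by (auto simp: E_def)
    show "emeasure \<mu> (E k) \<le> ennreal (K * real k powr (d + 2 - \<beta> * (a - b)))"
    proof (cases "adm k")
      case True
      have k: "real k > 0"
        using True by (simp add: adm_def)
      have R: "R k > 0"
        using k by (simp add: R_def)
      have "emeasure \<mu> (E k) \<le> (\<Sum>q\<in>S k. emeasure \<mu> (W \<inter> irregular (outer_target \<beta> k q) (R k) \<union>
          W \<inter> irregular (inner_target \<beta> k q) (R k)))"
        using True S(1)[OF True] irr(1) fmt
        by (auto simp: E_def intro!: emeasure_subadditive_finite)
      also have "\<dots> \<le> (\<Sum>q\<in>S k. ennreal (4 * c\<^sub>0 / R k))"
      proof (rule sum_mono)
        fix q assume q: "q \<in> S k"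
        have "emeasure \<mu> (W \<inter> irregular (outer_target \<beta> k q) (R k) \<union>
            W \<inter> irregular (inner_target \<beta> k q) (R k))
          \<le> emeasure \<mu> (W \<inter> irregular (outer_target \<beta> k q) (R k)) +
            emeasure \<mu> (W \<inter> irregular (inner_target \<beta> k q) (R k))"
          using irr(1) fmt True q by (intro emeasure_subadditive) auto
        also have "\<dots> \<le> ennreal (2 * c\<^sub>0 / R k) + ennreal (2 * c\<^sub>0 / R k)"
          using irr(2) fmt True q by (intro add_mono) auto
        also have "\<dots> = ennreal (4 * c\<^sub>0 / R k)"
          using second_moment(1) R by (subst ennreal_plus[symmetric]) auto
        finally show "emeasure \<mu> (W \<inter> irregular (outer_target \<beta> k q) (R k) \<union>
            W \<inter> irregular (inner_target \<beta> k q) (R k)) \<le> ennreal (4 * c\<^sub>0 / R k)" .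
      qed
      also have "\<dots> = ennreal (real (card (S k)) * (4 * c\<^sub>0 / R k))"
        using second_moment(1) R by (simp add: ennreal_of_nat_eq_real_of_nat flip: ennreal_mult)
      also have "\<dots> \<le> ennreal (K * real k powr (d + 2 - \<beta> * (a - b)))"
      proof (rule ennreal_leI)
        have "real (card (S k)) \<le> measure \<mu> Y / \<delta>\<^sub>0 * real k powr d"
          using S(3)[OF True] constants(1) k by (simp add: powr_divide field_simps)
        then have "real (card (S k)) * (4 * c\<^sub>0 / R k)
            \<le> measure \<mu> Y / \<delta>\<^sub>0 * real k powr d * (4 * c\<^sub>0 / R k)"
          using second_moment(1) R by (intro mult_right_mono) auto
        also have "\<dots> = K * (real k powr d / R k)"
          by (simp add: K_def)
        also have "real k powr d / R k = real k powr (d + 2 - \<beta> * (a - b))"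
          using k unfolding R_def by (subst powr_diff[symmetric]) (simp add: algebra_simps)
        finally show "real (card (S k)) * (4 * c\<^sub>0 / R k) \<le> K * real k powr (d + 2 - \<beta> * (a - b))" .
      qed
      finally show ?thesis .
    qed (simp add: E_def)
  qed
  have "AE g in \<mu>. \<forall>\<^sub>F k in sequentially. g \<in> space \<mu> - E k"
  proof (rule borel_cantelli_AE1)
    show "emeasure \<mu> (E k) < \<infinity>" for k
      using E(2)[of k] ennreal_less_top order_le_less_trans by (metis infinity_ennreal_def)
    have bound: "measure \<mu> (E k) \<le> K * real k powr (d + 2 - \<beta> * (a - b))" for k
      using E(2)[of k] K unfolding measure_def by (intro enn2real_leI) auto
    \<comment> \<open>The exponent is below -1 precisely because
      \<open>\<beta> * (a - b) > d + 3\<close>.\<close>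
    have "summable (\<lambda>k. K * real k powr (d + 2 - \<beta> * (a - b)))"
      using \<beta>(2) by (intro summable_mult) (simp add: summable_real_powr_iff)
    then show "summable (\<lambda>k. measure \<mu> (E k))"
      by (rule summable_comparison_test'[where N = 0]) (simp add: bound)
  qed (rule E(1))
  then have "AE g in \<mu>. g \<in> W \<longrightarrow> (\<forall>\<^sub>F k in sequentially. regular_at \<beta> k g)"
  proof eventually_elim
    case (elim g)
    show ?case
    proof
      assume g: "g \<in> W"
      show "\<forall>\<^sub>F k in sequentially. regular_at \<beta> k g"
        using elim adm
      proof eventually_elim
        case (elim k)
        obtain q where q: "q \<in> S k" "close (1 / real k) g q"
          using S(4)[OF elim(2) g] by blast
        then show ?case
          using elim g S(2)[OF elim(2)] W(3) unfolding regular_at_def E_def R_def[symmetric]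
          by (intro bexI[of _ q]) auto
      qed
    qed
  qed
  then show ?thesis
    using that W by blast
qed

text \<open>Lindelof's theorem covers \<open>G\<close> by countably many of the local
  neighbourhoods, so their null sets can be united.\<close>

lemma AE_regular_at:
  assumes \<beta>: "\<beta> > 0" "\<beta> * (a - b) > d + 3"
  shows "AE g in \<mu>. \<forall>\<^sub>F k in sequentially. regular_at \<beta> k g"
proof -
  define \<W> where "\<W> = {W. openin (top_of_set G) W \<and>
    (AE g in \<mu>. g \<in> W \<longrightarrow> (\<forall>\<^sub>F k in sequentially. regular_at \<beta> k g))}"
  have "\<And>W. W \<in> \<W> \<Longrightarrow> openin (top_of_set G) W"
    by (auto simp: \<W>_def)
  then obtain \<W>' where \<W>': "\<W>' \<subseteq> \<W>" "countable \<W>'" "\<Union>\<W>' = \<Union>\<W>"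
    by (rule Lindelof_openin)
  have cover: "G \<subseteq> \<Union>\<W>'"
  proof
    fix p assume "p \<in> G"
    then obtain W where "W \<in> \<W>" "p \<in> W"
      unfolding \<W>_def using regular_at_locally[OF _ \<beta>] by blast
    then show "p \<in> \<Union>\<W>'"
      using \<W>'(3) by blast
  qed
  have "AE g in \<mu>. \<forall>W\<in>\<W>'. g \<in> W \<longrightarrow> (\<forall>\<^sub>F k in sequentially. regular_at \<beta> k g)"
    using \<W>'(1) by (intro AE_ball_countable'[OF _ \<W>'(2)]) (auto simp: \<W>_def)
  with AE_space show ?thesis
  proof eventually_elim
    case (elim g)
    then show ?case
      using cover by (auto simp: space_\<mu>)
  qed
qed

text \<open>With \<open>\<beta> = 1 / \<nu>'\<close>, the inequality
  \<open>\<nu>' < \<delta>\<close> makes the volume error smaller than 1/k, and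
  \<open>\<nu> < \<nu>'\<close> leaves room to absorb every constant into t^(-\<nu>).\<close>

lemma count_asymptotics:
  assumes g: "g \<in> G" and \<nu>: "0 < \<nu>" "\<nu> < \<nu>'" "\<nu>' < \<delta>"
    and reg: "\<forall>\<^sub>F k in sequentially. regular_at (1 / \<nu>') k g"
  shows "\<exists>t\<^sub>0>1. \<forall>t\<ge>t\<^sub>0.
      finite {v \<in> L. F (act v g) \<in> \<Omega> t \<and> v \<in> B t} \<and>
      (\<exists>\<theta>. \<bar>\<theta>\<bar> \<le> t powr (- \<nu>) \<and>
           real (card {v \<in> L. F (act v g) \<in> \<Omega> t \<and> v \<in> B t}) = c g * t powr (a - b) * (1 + \<theta>))"
proof -
  define \<beta> where "\<beta> = 1 / \<nu>'"
  have \<beta>: "\<beta> > 0" "\<beta> * \<delta> > 1" "\<beta> * \<nu> < 1"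
    using \<nu> by (auto simp: \<beta>_def field_simps)
  define P where "P t \<longleftrightarrow> finite {v \<in> L. F (act v g) \<in> \<Omega> t \<and> v \<in> B t} \<and>
      (\<exists>\<theta>. \<bar>\<theta>\<bar> \<le> t powr (- \<nu>) \<and>
           real (card {v \<in> L. F (act v g) \<in> \<Omega> t \<and> v \<in> B t}) = c g * t powr (a - b) * (1 + \<theta>))" for t
  have "\<forall>\<^sub>F k in sequentially. real k powr \<beta> / ((real k + 1) / (real k - 1))\<^sup>2 \<ge> 1"
    using \<beta>(1) by real_asymp
  then have "\<forall>\<^sub>F k in sequentially. \<forall>t. real k powr \<beta> \<le> t \<longrightarrow> t \<le> (real k + 1) powr \<beta> \<longrightarrow> P t"
    using reg[folded \<beta>_def] eventually_ge_at_top[of 2]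
      counting_sandwich[OF b_range \<beta>(1,2) \<nu>(1) \<beta>(3), of "c g" "C g"]
  proof eventually_elim
    case (elim k)
    show ?case
    proof (intro allI impI)
      fix t assume t: "real k powr \<beta> \<le> t" "t \<le> (real k + 1) powr \<beta>"
      define \<rho> where "\<rho> = (real k + 1) / (real k - 1)"
      have k: "real k powr \<beta> > 1" "(real k + 1) powr \<beta> > 1"
        using elim(3) \<beta>(1) by (auto intro!: gr_one_powr)
      have "\<rho> \<ge> 1"
        using elim(3) by (simp add: \<rho>_def)
      then have big: "(real k + 1) powr \<beta> * \<rho>\<^sup>2 \<ge> 1"
        using k mult_mono[of 1 "(real k + 1) powr \<beta>" 1 "\<rho>\<^sup>2"] by simp
      obtain \<theta>\<^sub>1 where 1: "\<bar>\<theta>\<^sub>1\<bar> \<le> C g * ((real k + 1) powr \<beta> * \<rho>\<^sup>2) powr (- \<delta>)"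
        "measure m (target (\<Omega> (real k powr \<beta>)) ((real k + 1) powr \<beta> * \<rho>\<^sup>2) g)
          = c g * (real k powr \<beta>) powr (- b) * ((real k + 1) powr \<beta> * \<rho>\<^sup>2) powr a * (1 + \<theta>\<^sub>1)"
        using measure_target[OF k(1) g big] by blast
      obtain \<theta>\<^sub>2 where 2: "\<bar>\<theta>\<^sub>2\<bar> \<le> C g * (real k powr \<beta> / \<rho>\<^sup>2) powr (- \<delta>)"
        "measure m (target (\<Omega> ((real k + 1) powr \<beta>)) (real k powr \<beta> / \<rho>\<^sup>2) g)
          = c g * ((real k + 1) powr \<beta>) powr (- b) * (real k powr \<beta> / \<rho>\<^sup>2) powr a * (1 + \<theta>\<^sub>2)"
        using measure_target[OF k(2) g elim(1)[folded \<rho>_def]] by blast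
      note cnt = count_of_regular_at[OF g \<beta>(1) elim(2,3,1) t, folded \<rho>_def]
      show "P t"
        unfolding P_def
        using cnt(1) elim(4)[unfolded Let_def, folded \<rho>_def, rule_format, OF t 1(2,1) measure_nonneg
            2(2,1) measure_nonneg cnt(2,3)]
        by blast
    qed
  qed
  then obtain k\<^sub>0 where k0: "\<And>k t. k \<ge> k\<^sub>0 \<Longrightarrow> real k powr \<beta> \<le> t \<Longrightarrow> t \<le> (real k + 1) powr \<beta> \<Longrightarrow> P t"
    unfolding eventually_sequentially by blast
  \<comment> \<open>The summand 2 gives \<open>t\<^sub>0 > 1\<close> even when
    \<open>k\<^sub>0 = 0\<close>.\<close>
  define t\<^sub>0 where "t\<^sub>0 = (real k\<^sub>0 + 2) powr \<beta>"
  have "P t" if t: "t \<ge> t\<^sub>0" for t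
  proof -
    have "t > 0"
      using t by (smt (verit) t\<^sub>0_def of_nat_0_le_iff powr_gt_zero)
    \<comment> \<open>The block containing \<open>t\<close> has index k equal to the floor of
      t^\<nu>'.\<close>
    define x where "x = t powr \<nu>'"
    have x: "x powr \<beta> = t" "x \<ge> 0"
      using \<open>t > 0\<close> \<nu> by (auto simp: x_def \<beta>_def powr_powr)
    have "(real k\<^sub>0 + 2) = t\<^sub>0 powr \<nu>'"
      using \<nu> by (simp add: t\<^sub>0_def \<beta>_def powr_powr)
    also have "\<dots> \<le> x"
      unfolding x_def using t \<nu> by (intro powr_mono2) (auto simp: t\<^sub>0_def)
    finally have k: "nat \<lfloor>x\<rfloor> \<ge> k\<^sub>0"
      by linarith
    have "real (nat \<lfloor>x\<rfloor>) \<le> x" "x \<le> real (nat \<lfloor>x\<rfloor>) + 1"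
      using x(2) by linarith+
    then have "real (nat \<lfloor>x\<rfloor>) powr \<beta> \<le> t" "t \<le> (real (nat \<lfloor>x\<rfloor>) + 1) powr \<beta>"
      unfolding x(1)[symmetric] using \<beta>(1) x(2) by (auto intro!: powr_mono2)
    then show "P t"
      by (rule k0[OF k])
  qed
  moreover have "t\<^sub>0 > 1"
    using \<beta>(1) by (auto simp: t\<^sub>0_def intro!: gr_one_powr)
  ultimately show ?thesis
    unfolding P_def by blast
qed

end

theorem theorem3p14:
  fixes V :: "(real^'d) set"
    and G :: "(real^'n^'n) set"
    and act :: "real^'d \<Rightarrow> real^'n^'n \<Rightarrow> real^'d"
    and \<Gamma> :: "(real^'n^'n) set"
    and L :: "(real^'d) set"
    and \<mu>q :: "(real^'n^'n) set measure"
    and \<mu> :: "(real^'n^'n) measure"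
    and m :: "(real^'d) measure"
    and O_nbhd :: "real \<Rightarrow> (real^'n^'n) set"
    and B :: "real \<Rightarrow> (real^'d) set"
    and F :: "real^'d \<Rightarrow> real^'m"
    and \<Upsilon> :: "(real^'m) set set"
    and \<Omega> :: "real \<Rightarrow> (real^'m) set"
    and c C :: "real^'n^'n \<Rightarrow> real"
    and c\<^sub>0 \<delta>\<^sub>0 d \<eta> a b \<delta> \<nu> :: real
  assumes setting: "orbit_counting V G act \<Gamma> L \<mu>q \<mu> m"
    and second_moment: "c\<^sub>0 > 0" "fmeasurable m \<subseteq> A1 act L \<mu>q m c\<^sub>0"
    and constants: "\<delta>\<^sub>0 > 0" "d > 0" "\<eta> > 0" "a > 0" "\<delta> > 0"
    and nbhds: "\<And>\<epsilon>. 0 < \<epsilon> \<Longrightarrow> \<epsilon> \<le> 1 \<Longrightarrow> identity_nbhd G (O_nbhd \<epsilon>)"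
    and nbhds_measure: "\<And>\<epsilon>. 0 < \<epsilon> \<Longrightarrow> \<epsilon> \<le> 1 \<Longrightarrow>
        O_nbhd \<epsilon> \<in> fmeasurable \<mu> \<and> measure \<mu> (O_nbhd \<epsilon>) \<ge> \<delta>\<^sub>0 * \<epsilon> powr d"
    and nbhds_mult: "\<And>\<epsilon>\<^sub>1 \<epsilon>\<^sub>2. 0 < \<epsilon>\<^sub>1 \<Longrightarrow> \<epsilon>\<^sub>1 \<le> 1 \<Longrightarrow> 0 < \<epsilon>\<^sub>2 \<Longrightarrow> \<epsilon>\<^sub>2 \<le> 1 \<Longrightarrow>
        \<eta> * (\<epsilon>\<^sub>1 + \<epsilon>\<^sub>2) \<le> 1 \<Longrightarrow>
        O_nbhd \<epsilon>\<^sub>1 <#>\<^bsub>GL\<^esub> O_nbhd \<epsilon>\<^sub>2 \<subseteq> O_nbhd (\<eta> * (\<epsilon>\<^sub>1 + \<epsilon>\<^sub>2))"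
    and B_subset: "\<And>t. t \<ge> 1 \<Longrightarrow> B t \<subseteq> V"
    and B_increasing: "\<And>s t. 1 \<le> s \<Longrightarrow> s \<le> t \<Longrightarrow> B s \<subseteq> B t"
    and B_inner: "\<And>t \<epsilon>. t \<ge> 1 \<Longrightarrow> 0 < \<epsilon> \<Longrightarrow> \<epsilon> \<le> 1 \<Longrightarrow> t * (1 - \<epsilon>) \<ge> 1 \<Longrightarrow>
        B (t * (1 - \<epsilon>)) \<subseteq> (\<Inter>h\<in>O_nbhd \<epsilon>. act_set act (B t) {h})"
    and B_outer: "\<And>t \<epsilon>. t \<ge> 1 \<Longrightarrow> 0 < \<epsilon> \<Longrightarrow> \<epsilon> \<le> 1 \<Longrightarrow>
        (\<Union>h\<in>O_nbhd \<epsilon>. act_set act (B t) {h}) \<subseteq> B (t * (1 + \<epsilon>))"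
    and \<Upsilon>_finite_volume: "\<Upsilon> \<subseteq> fmeasurable lborel"
    and volume_asymptotics: "\<And>X g t. X \<in> \<Upsilon> \<Longrightarrow> g \<in> G \<Longrightarrow> t \<ge> 1 \<Longrightarrow>
        F_preimage V act F g X \<inter> B t \<in> fmeasurable m \<and>
        (\<exists>\<theta>. \<bar>\<theta>\<bar> \<le> C g * t powr (- \<delta>) \<and>
             measure m (F_preimage V act F g X \<inter> B t)
               = c g * measure lborel X * t powr a * (1 + \<theta>))"
    and locally_bounded: "\<And>K. compact K \<Longrightarrow> K \<subseteq> G \<Longrightarrow> bounded (c ` K) \<and> bounded (C ` K)"
    and \<Omega>_in: "\<And>t. t > 1 \<Longrightarrow> \<Omega> t \<in> \<Upsilon>"
    and \<Omega>_decreasing: "\<And>s t. 1 < s \<Longrightarrow> s \<le> t \<Longrightarrow> \<Omega> t \<subseteq> \<Omega> s"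
    and \<Omega>_volume: "\<And>t. t > 1 \<Longrightarrow> measure lborel (\<Omega> t) = t powr (- b)"
    and b_range: "0 < b" "b < a"
    and \<nu>_range: "0 < \<nu>" "\<nu> < min \<delta> ((a - b) / (d + 3))"
  shows "\<exists>M. AE g in \<mu>. \<exists>t\<^sub>0>1. \<forall>t\<ge>t\<^sub>0.
      finite {v \<in> L. F (act v g) \<in> \<Omega> t \<and> v \<in> B t} \<and>
      (\<exists>\<theta>. \<bar>\<theta>\<bar> \<le> M * t powr (- \<nu>) \<and>
           real (card {v \<in> L. F (act v g) \<in> \<Omega> t \<and> v \<in> B t})
             = c g * measure lborel (\<Omega> t) * t powr a * (1 + \<theta>))"
proof -
  interpret orbit_counting V G act \<Gamma> L \<mu>q \<mu> m
    by (rule setting)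
  interpret shrinking_targets V G act \<Gamma> L \<mu>q \<mu> m O_nbhd B F \<Omega> c C c\<^sub>0 \<delta>\<^sub>0 d \<eta> a b \<delta>
  proof unfold_locales
    show "F_preimage V act F g (\<Omega> s) \<inter> B t \<in> fmeasurable m \<and>
        (\<exists>\<theta>. \<bar>\<theta>\<bar> \<le> C g * t powr (- \<delta>) \<and>
             measure m (F_preimage V act F g (\<Omega> s) \<inter> B t)
               = c g * s powr (- b) * t powr a * (1 + \<theta>))"
      if "s > 1" "g \<in> G" "t \<ge> 1" for s g t
      using volume_asymptotics[OF \<Omega>_in[OF that(1)] that(2,3)] \<Omega>_volume[OF that(1)] by simp
  qed (fact assms)+
  \<comment> \<open>The first bound on \<open>\<nu>'\<close> governs the volume error, the second
    the summability of the exceptional sets.\<close>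
  obtain \<nu>' where \<nu>': "\<nu> < \<nu>'" "\<nu>' < min \<delta> ((a - b) / (d + 3))"
    using dense[OF \<nu>_range(2)] by blast
  have \<beta>: "1 / \<nu>' > 0" "1 / \<nu>' * (a - b) > d + 3"
    using \<nu>' \<nu>_range(1) \<open>d > 0\<close> by (auto simp: field_simps)
  have \<delta>: "\<nu>' < \<delta>"
    using \<nu>'(2) by simp
  have vol: "c g * t powr (a - b) = c g * measure lborel (\<Omega> t) * t powr a" if "t > 1" for g t
    using \<Omega>_volume[OF that] that by (simp add: powr_diff powr_minus field_simps)
  \<comment> \<open>The slack between \<open>\<nu>\<close> and \<open>\<nu>'\<close> allows the
    uniform constant \<open>M = 1\<close>; only \<open>t\<^sub>0\<close> depends on
    \<open>g\<close>.\<close>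
  have "AE g in \<mu>. \<exists>t\<^sub>0>1. \<forall>t\<ge>t\<^sub>0.
      finite {v \<in> L. F (act v g) \<in> \<Omega> t \<and> v \<in> B t} \<and>
      (\<exists>\<theta>. \<bar>\<theta>\<bar> \<le> 1 * t powr (- \<nu>) \<and>
           real (card {v \<in> L. F (act v g) \<in> \<Omega> t \<and> v \<in> B t})
             = c g * measure lborel (\<Omega> t) * t powr a * (1 + \<theta>))"
    using AE_space AE_regular_at[OF \<beta>]
  proof eventually_elim
    case (elim g)
    then have g: "g \<in> G"
      by (simp add: space_\<mu>)
    obtain t\<^sub>0 where t0: "t\<^sub>0 > 1" and count: "\<forall>t\<ge>t\<^sub>0.
      finite {v \<in> L. F (act v g) \<in> \<Omega> t \<and> v \<in> B t} \<and>
      (\<exists>\<theta>. \<bar>\<theta>\<bar> \<le> t powr (- \<nu>) \<and>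
           real (card {v \<in> L. F (act v g) \<in> \<Omega> t \<and> v \<in> B t}) = c g * t powr (a - b) * (1 + \<theta>))"
      using count_asymptotics[OF g \<nu>_range(1) \<nu>'(1) \<delta> elim(2)] by blast
    show ?case
    proof (intro exI[of _ t\<^sub>0] conjI[OF t0] allI impI)
      fix t assume t: "t\<^sub>0 \<le> t"
      then have t1: "t > 1"
        using t0 by simp
      show "finite {v \<in> L. F (act v g) \<in> \<Omega> t \<and> v \<in> B t} \<and>
        (\<exists>\<theta>. \<bar>\<theta>\<bar> \<le> 1 * t powr (- \<nu>) \<and>
           real (card {v \<in> L. F (act v g) \<in> \<Omega> t \<and> v \<in> B t})
             = c g * measure lborel (\<Omega> t) * t powr a * (1 + \<theta>))"
        using count[rule_format, OF t] unfolding vol[OF t1] mult_1 .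
    qed
  qed
  then show ?thesis
    by blast
qed

end
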